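(* Let $\mathbb{H}^n=\mathbb{W}\rtimes\mathbb{V}$ be a semidirect factorization of the Heisenberg group with $\mathbb{W}$ vertical and $\mathbb{V}$ horizontal, equipped with a homogeneous distance $d$. Let $U\subset\mathbb{W}$ and $\Omega\subset\mathbb{H}^n$ be open, and let $f:\Omega\to\mathbb{R}^k$ and $\phi:U\to\mathbb{V}$ be functions such that $\Phi(U)\subset\Omega$, where $\Phi(u)=u\phi(u)$ is the graph map of $\phi$. Let $x_{\mathbb{W}}\in U$ and $x=\Phi(x_{\mathbb{W}})$. If $f$ is h-differentiable at $x$ and $\phi$ is intrinsic differentiable at $x_{\mathbb{W}}$, then the composition $F=f\circ\Phi:U\to\mathbb{R}^k$, $F(u)=f(u\phi(u))$, is extrinsically differentiable at $x_{\mathbb{W}}$ with respect to $(\mathbb{V},x)$, and for every $w\in\mathbb{W}$ $$d^{\mathbb{V}}_xF(w)=Df(x)\big(w\,d\phi_{x_{\mathbb{W}}}(w)\big).$$ If in addition $f(w\phi(w))=c$ for every $w\in U$ and some $c\in\mathbb{R}^k$, then $$\ker(Df(x))=\mathrm{graph}(d\phi_{x_{\mathbb{W}}})=\{w\,d\phi_{x_{\mathbb{W}}}(w):w\in\mathbb{W}\}.$$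
   Context: Heisenberg group: $\mathbb{H}^n=H_1\oplus H_2$ is a real vector space, $\dim H_1=2n$, $\dim H_2=1$, with a symplectic form $\omega$ on $H_1$ and a fixed $0\ne e_{2n+1}\in H_2$; $\pi_{H_1}$ is the projection on $H_1$, $[p,q]=\omega(\pi_{H_1}p,\pi_{H_1}q)e_{2n+1}$ and $pq=p+q+\frac12[p,q]$ (identity $0$). Dilations: $\delta_t$ is linear with $\delta_t w=t^iw$ for $w\in H_i$, $t>0$. A homogeneous distance $d$ is a distance on $\mathbb{H}^n$ with $d(zx,zy)=d(x,y)$ and $d(\delta_tx,\delta_ty)=t\,d(x,y)$; $\|x\|=d(x,0)$. Homogeneous subgroups are Lie subgroups closed under all $\delta_t$; vertical ones contain $H_2$, horizontal ones are contained in $H_1$. $\mathbb{H}^n=\mathbb{W}\rtimes\mathbb{V}$ means $\mathbb{W}$ vertical, $\mathbb{V}$ horizontal, $\mathbb{H}^n=\mathbb{W}\mathbb{V}$, $\mathbb{W}\cap\mathbb{V}=\{0\}$; then $x=\pi_{\mathbb{W}}(x)\pi_{\mathbb{V}}(x)$ uniquely. An h-homomorphism is a group homomorphism commuting with dilations (on $\mathbb{R}^k$ dilations are $y\mapsto ty$; on homogeneous subgroups they are the $\delta_t$). $f:\Omega\to\mathbb{R}^k$ is h-differentiable (Pansu differentiable) at $x$ if there is a (unique) h-homomorphism $Df(x):\mathbb{H}^n\to\mathbb{R}^k$ with $|f(xw)-f(x)-Df(x)(w)|=o(\|w\|)$ as $w\to0$. For $x\in\mathbb{H}^n$ let $\sigma_x:\mathbb{W}\to\mathbb{W}$,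 $\sigma_x(w)=xw\,\pi_{\mathbb{V}}(x)^{-1}$ (a bijection with inverse $\sigma_{x^{-1}}$). For $\phi:U\to\mathbb{V}$ the translated function is $\phi_x(w)=\pi_{\mathbb{V}}(x)\phi(\sigma_{x^{-1}}(w))$, $w\in\sigma_x(U)$. $\phi$ is intrinsic differentiable at $\bar w\in U$ if, with $x=\bar w\phi(\bar w)$, there is a (unique) h-homomorphism $d\phi_{\bar w}:\mathbb{W}\to\mathbb{V}$ with $d(d\phi_{\bar w}(w),\phi_{x^{-1}}(w))=o(\|w\|)$ as $w\to0$. Extrinsic differentiability: let $F:U\to\mathbb{R}^k$, $u\in U$, $v\in\mathbb{V}$, $x=uv$, and $F^{\mathbb{V}}_{x^{-1}}(w)=F(\sigma_x(w))-F(u)$ for $w\in\sigma_{x^{-1}}(U)$. $F$ is extrinsically differentiable at $u$ with respect to $(\mathbb{V},x)$ if there is a (unique) h-homomorphism $L:\mathbb{W}\to\mathbb{R}^k$ with $|F^{\mathbb{V}}_{x^{-1}}(w)-L(w)|/\|w\|\to0$ as $w\to0$; one writes $d^{\mathbb{V}}_xF=L$.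
   Formalization: The equality ker(Df(x)) = graph(dφ) fails e.g. for constant f, φ = 0 and nontrivial V; it is stated under the added hypothesis that Df(x) is injective on V, which the equality forces. Without it only graph(dφ) ⊂ ker(Df(x)) is claimed. *)

theory Defs
  imports "HOL-Analysis.Analysis" "HOL-Algebra.Coset"
begin

section \<open>The Heisenberg group\<close>

text \<open>
  A Heisenberg group is carried by a finite-dimensional real vector space, so the group record is
  extended by the two layers, the symplectic form on the first layer and the fixed vector of the
  second layer. Of the class \<^class>\<open>euclidean_space\<close> only the vector space structure and its (unique)
  vector space topology are used; the layers are not assumed to be orthogonal.
\<close>

record 'a heis = "'a monoid" +
  layer1 :: "'a set"
  layer2 :: "'a set"
  symp :: "'a \<Rightarrow> 'a \<Rightarrow> real"
  vert :: 'a

definition symplectic_form_on :: "'a::real_vector set \<Rightarrow> ('a \<Rightarrow> 'a \<Rightarrow> real) \<Rightarrow> bool" where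
  "symplectic_form_on S \<omega> \<longleftrightarrow>
     (\<forall>x\<in>S. \<forall>y\<in>S. \<forall>z\<in>S. \<forall>a b. \<omega> (a *\<^sub>R x + b *\<^sub>R y) z = a * \<omega> x z + b * \<omega> y z) \<and>
     (\<forall>x\<in>S. \<forall>y\<in>S. \<omega> x y = - \<omega> y x) \<and>
     (\<forall>x\<in>S. (\<forall>y\<in>S. \<omega> x y = 0) \<longrightarrow> x = 0)"

definition proj1 :: "('a::real_vector) heis \<Rightarrow> 'a \<Rightarrow> 'a" where
  "proj1 G p = (THE a. a \<in> layer1 G \<and> p - a \<in> layer2 G)"

definition heis_bracket :: "('a::real_vector) heis \<Rightarrow> 'a \<Rightarrow> 'a \<Rightarrow> 'a" where
  "heis_bracket G p q = symp G (proj1 G p) (proj1 G q) *\<^sub>R vert G"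

definition heisenberg :: "nat \<Rightarrow> ('a::euclidean_space) heis \<Rightarrow> bool" where
  "heisenberg n G \<longleftrightarrow>
     subspace (layer1 G) \<and> subspace (layer2 G) \<and>
     layer1 G \<inter> layer2 G = {0} \<and> (\<forall>p. \<exists>a\<in>layer1 G. \<exists>b\<in>layer2 G. p = a + b) \<and>
     dim (layer1 G) = 2 * n \<and> dim (layer2 G) = 1 \<and>
     symplectic_form_on (layer1 G) (symp G) \<and>
     vert G \<in> layer2 G \<and> vert G \<noteq> 0 \<and>
     carrier G = UNIV \<and> one G = 0 \<and>
     (\<forall>p q. p \<otimes>\<^bsub>G\<^esub> q = p + q + (1/2) *\<^sub>R heis_bracket G p q)"

definition dilation :: "('a::real_vector) heis \<Rightarrow> real \<Rightarrow> 'a \<Rightarrow> 'a" where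
  "dilation G t p = t *\<^sub>R proj1 G p + t\<^sup>2 *\<^sub>R (p - proj1 G p)"

text \<open>
  No continuity of \<open>d\<close> is required: a homogeneous distance induces the vector space topology
  automatically, so the limits \<open>w \<rightarrow> 0\<close> below may be taken in that topology.
\<close>

definition homogeneous_distance :: "('a::real_vector) heis \<Rightarrow> ('a \<Rightarrow> 'a \<Rightarrow> real) \<Rightarrow> bool" where
  "homogeneous_distance G d \<longleftrightarrow>
     Metric_space UNIV d \<and>
     (\<forall>x y z. d (z \<otimes>\<^bsub>G\<^esub> x) (z \<otimes>\<^bsub>G\<^esub> y) = d x y) \<and>
     (\<forall>t>0. \<forall>x y. d (dilation G t x) (dilation G t y) = t * d x y)"

section \<open>Homogeneous subgroups and factorizations\<close>

text \<open>Lie subgroups are rendered as closed subgroups (Cartan's theorem).\<close>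

definition homogeneous_subgroup :: "'a set \<Rightarrow> ('a::euclidean_space) heis \<Rightarrow> bool" where
  "homogeneous_subgroup S G \<longleftrightarrow>
     subgroup S G \<and> closed S \<and> (\<forall>t>0. \<forall>x\<in>S. dilation G t x \<in> S)"

definition semidirect_factorization ::
    "('a::euclidean_space) heis \<Rightarrow> 'a set \<Rightarrow> 'a set \<Rightarrow> bool" where
  "semidirect_factorization G W V \<longleftrightarrow>
     homogeneous_subgroup W G \<and> layer2 G \<subseteq> W \<and>
     homogeneous_subgroup V G \<and> V \<subseteq> layer1 G \<and>
     W <#>\<^bsub>G\<^esub> V = carrier G \<and> W \<inter> V = {0}"

definition projW :: "('a::euclidean_space) heis \<Rightarrow> 'a set \<Rightarrow> 'a set \<Rightarrow> 'a \<Rightarrow> 'a" where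
  "projW G W V x = (THE w. w \<in> W \<and> (\<exists>v\<in>V. x = w \<otimes>\<^bsub>G\<^esub> v))"

definition projV :: "('a::euclidean_space) heis \<Rightarrow> 'a set \<Rightarrow> 'a set \<Rightarrow> 'a \<Rightarrow> 'a" where
  "projV G W V x = (THE v. v \<in> V \<and> (\<exists>w\<in>W. x = w \<otimes>\<^bsub>G\<^esub> v))"

section \<open>h-homomorphisms and differentiability\<close>

definition additive_group :: "('b::real_vector) monoid" where
  "additive_group = \<lparr>carrier = UNIV, mult = (+), one = 0\<rparr>"

definition h_hom :: "('a, 'm) monoid_scheme \<Rightarrow> (real \<Rightarrow> 'a \<Rightarrow> 'a) \<Rightarrow>
    ('b, 'n) monoid_scheme \<Rightarrow> (real \<Rightarrow> 'b \<Rightarrow> 'b) \<Rightarrow> ('a \<Rightarrow> 'b) set" where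
  "h_hom A \<delta> B \<epsilon> = {L \<in> hom A B. \<forall>t>0. \<forall>x\<in>carrier A. L (\<delta> t x) = \<epsilon> t (L x)}"

text \<open>
  The differentials below are unique on their domain (the whole group, respectively \<open>W\<close>); the
  choice operator only selects their irrelevant values outside \<open>W\<close>.
\<close>

definition has_h_derivative :: "('a::euclidean_space) heis \<Rightarrow> ('a \<Rightarrow> 'a \<Rightarrow> real) \<Rightarrow>
    'a set \<Rightarrow> ('a \<Rightarrow> 'b::real_normed_vector) \<Rightarrow> 'a \<Rightarrow> ('a \<Rightarrow> 'b) \<Rightarrow> bool" where
  "has_h_derivative G d \<Omega> f x L \<longleftrightarrow>
     L \<in> h_hom G (dilation G) additive_group (*\<^sub>R) \<and>
     ((\<lambda>w. norm (f (x \<otimes>\<^bsub>G\<^esub> w) - f x - L w) / d w 0) \<longlongrightarrow> 0)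
       (at 0 within {w. x \<otimes>\<^bsub>G\<^esub> w \<in> \<Omega>})"

definition h_differentiable :: "('a::euclidean_space) heis \<Rightarrow> ('a \<Rightarrow> 'a \<Rightarrow> real) \<Rightarrow>
    'a set \<Rightarrow> ('a \<Rightarrow> 'b::real_normed_vector) \<Rightarrow> 'a \<Rightarrow> bool" where
  "h_differentiable G d \<Omega> f x \<longleftrightarrow> x \<in> \<Omega> \<and> (\<exists>L. has_h_derivative G d \<Omega> f x L)"

definition h_derivative :: "('a::euclidean_space) heis \<Rightarrow> ('a \<Rightarrow> 'a \<Rightarrow> real) \<Rightarrow>
    'a set \<Rightarrow> ('a \<Rightarrow> 'b::real_normed_vector) \<Rightarrow> 'a \<Rightarrow> 'a \<Rightarrow> 'b" where
  "h_derivative G d \<Omega> f x = (SOME L. has_h_derivative G d \<Omega> f x L)"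

definition sigma :: "('a::euclidean_space) heis \<Rightarrow> 'a set \<Rightarrow> 'a set \<Rightarrow> 'a \<Rightarrow> 'a \<Rightarrow> 'a" where
  "sigma G W V x w = x \<otimes>\<^bsub>G\<^esub> w \<otimes>\<^bsub>G\<^esub> inv\<^bsub>G\<^esub> (projV G W V x)"

definition graph_map :: "('a::euclidean_space) heis \<Rightarrow> ('a \<Rightarrow> 'a) \<Rightarrow> 'a \<Rightarrow> 'a" where
  "graph_map G \<phi> u = u \<otimes>\<^bsub>G\<^esub> \<phi> u"

text \<open>The translated function \<open>\<phi>\<^sub>x\<close>; its domain is \<open>\<sigma>\<^sub>x(U)\<close> if that of \<open>\<phi>\<close> is \<open>U\<close>.\<close>

definition intrinsic_translate :: "('a::euclidean_space) heis \<Rightarrow> 'a set \<Rightarrow> 'a set \<Rightarrow>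
    ('a \<Rightarrow> 'a) \<Rightarrow> 'a \<Rightarrow> 'a \<Rightarrow> 'a" where
  "intrinsic_translate G W V \<phi> x w =
     projV G W V x \<otimes>\<^bsub>G\<^esub> \<phi> (sigma G W V (inv\<^bsub>G\<^esub> x) w)"

definition has_intrinsic_derivative :: "('a::euclidean_space) heis \<Rightarrow> ('a \<Rightarrow> 'a \<Rightarrow> real) \<Rightarrow>
    'a set \<Rightarrow> 'a set \<Rightarrow> 'a set \<Rightarrow> ('a \<Rightarrow> 'a) \<Rightarrow> 'a \<Rightarrow> ('a \<Rightarrow> 'a) \<Rightarrow> bool" where
  "has_intrinsic_derivative G d W V U \<phi> u L \<longleftrightarrow>
     L \<in> h_hom (G\<lparr>carrier := W\<rparr>) (dilation G) (G\<lparr>carrier := V\<rparr>) (dilation G) \<and>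
     (let x = graph_map G \<phi> u in
       ((\<lambda>w. d (L w) (intrinsic_translate G W V \<phi> (inv\<^bsub>G\<^esub> x) w) / d w 0) \<longlongrightarrow> 0)
         (at 0 within sigma G W V (inv\<^bsub>G\<^esub> x) ` U))"

definition intrinsic_differentiable :: "('a::euclidean_space) heis \<Rightarrow> ('a \<Rightarrow> 'a \<Rightarrow> real) \<Rightarrow>
    'a set \<Rightarrow> 'a set \<Rightarrow> 'a set \<Rightarrow> ('a \<Rightarrow> 'a) \<Rightarrow> 'a \<Rightarrow> bool" where
  "intrinsic_differentiable G d W V U \<phi> u \<longleftrightarrow>
     u \<in> U \<and> (\<exists>L. has_intrinsic_derivative G d W V U \<phi> u L)"

definition intrinsic_derivative :: "('a::euclidean_space) heis \<Rightarrow> ('a \<Rightarrow> 'a \<Rightarrow> real) \<Rightarrow>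
    'a set \<Rightarrow> 'a set \<Rightarrow> 'a set \<Rightarrow> ('a \<Rightarrow> 'a) \<Rightarrow> 'a \<Rightarrow> 'a \<Rightarrow> 'a" where
  "intrinsic_derivative G d W V U \<phi> u = (SOME L. has_intrinsic_derivative G d W V U \<phi> u L)"

text \<open>The base point \<open>u\<close> of \<open>x = uv\<close> is determined by \<open>x\<close>, namely \<open>u = \<pi>\<^sub>W(x)\<close>.\<close>

definition has_extrinsic_derivative :: "('a::euclidean_space) heis \<Rightarrow> ('a \<Rightarrow> 'a \<Rightarrow> real) \<Rightarrow>
    'a set \<Rightarrow> 'a set \<Rightarrow> 'a set \<Rightarrow> ('a \<Rightarrow> 'b::real_normed_vector) \<Rightarrow> 'a \<Rightarrow> ('a \<Rightarrow> 'b) \<Rightarrow> bool" where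
  "has_extrinsic_derivative G d W V U F x L \<longleftrightarrow>
     L \<in> h_hom (G\<lparr>carrier := W\<rparr>) (dilation G) additive_group (*\<^sub>R) \<and>
     ((\<lambda>w. norm (F (sigma G W V x w) - F (projW G W V x) - L w) / d w 0) \<longlongrightarrow> 0)
       (at 0 within sigma G W V (inv\<^bsub>G\<^esub> x) ` U)"

definition extrinsically_differentiable :: "('a::euclidean_space) heis \<Rightarrow> ('a \<Rightarrow> 'a \<Rightarrow> real) \<Rightarrow>
    'a set \<Rightarrow> 'a set \<Rightarrow> 'a set \<Rightarrow> ('a \<Rightarrow> 'b::real_normed_vector) \<Rightarrow> 'a \<Rightarrow> 'a \<Rightarrow> bool" where
  "extrinsically_differentiable G d W V U F u x \<longleftrightarrow>
     u \<in> U \<and> (\<exists>v\<in>V. x = u \<otimes>\<^bsub>G\<^esub> v) \<and> (\<exists>L. has_extrinsic_derivative G d W V U F x L)"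

definition extrinsic_derivative :: "('a::euclidean_space) heis \<Rightarrow> ('a \<Rightarrow> 'a \<Rightarrow> real) \<Rightarrow>
    'a set \<Rightarrow> 'a set \<Rightarrow> 'a set \<Rightarrow> ('a \<Rightarrow> 'b::real_normed_vector) \<Rightarrow> 'a \<Rightarrow> 'a \<Rightarrow> 'b" where
  "extrinsic_derivative G d W V U F x = (SOME L. has_extrinsic_derivative G d W V U F x L)"

section \<open>Kernels and graphs\<close>

lemma proj1_add:
  assumes "heisenberg n G"
  shows "proj1 G p \<in> layer1 G" "p - proj1 G p \<in> layer2 G"
    "proj1 G (p + q) = proj1 G p + proj1 G q" "b \<in> layer2 G \<Longrightarrow> proj1 G b = 0"
    "proj1 G (- p) = - proj1 G p"
proof -
  have s: "subspace (layer1 G)" "subspace (layer2 G)" and i: "layer1 G \<inter> layer2 G = {0}"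
    and sp: "\<forall>p. \<exists>a\<in>layer1 G. \<exists>b\<in>layer2 G. p = a + b"
    using assms by (auto simp: heisenberg_def)
  have eq: "proj1 G p = a" if "a \<in> layer1 G" "p - a \<in> layer2 G" for p a
    unfolding proj1_def
  proof (rule the_equality)
    fix a' assume "a' \<in> layer1 G \<and> p - a' \<in> layer2 G"
    then have "a' - a \<in> layer1 G" "(p - a) - (p - a') \<in> layer2 G"
      using that s subspace_diff by blast+
    moreover have "(p - a) - (p - a') = a' - a" by simp
    ultimately show "a' = a" using i by (metis IntI eq_iff_diff_eq_0 singletonD)
  qed (use that in auto)
  have m: "proj1 G p \<in> layer1 G \<and> p - proj1 G p \<in> layer2 G" for p
  proof -
    obtain a b where "a \<in> layer1 G" "b \<in> layer2 G" "p = a + b" using sp by blast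
    then show ?thesis using eq[of a p] by simp
  qed
  show "proj1 G p \<in> layer1 G" "p - proj1 G p \<in> layer2 G" using m by auto
  show "proj1 G (p + q) = proj1 G p + proj1 G q"
  proof (rule eq)
    have "(p - proj1 G p) + (q - proj1 G q) \<in> layer2 G" using m s subspace_add by blast
    then show "p + q - (proj1 G p + proj1 G q) \<in> layer2 G" by (simp add: algebra_simps)
  qed (use m s subspace_add in blast)
  show "proj1 G b = 0" if "b \<in> layer2 G" using that eq[of 0 b] s subspace_0 by auto
  show "proj1 G (- p) = - proj1 G p"
  proof (rule eq)
    have "- (p - proj1 G p) \<in> layer2 G" using m s subspace_neg by blast
    then show "- p - - proj1 G p \<in> layer2 G" by (simp add: algebra_simps)
  qed (use m s subspace_neg in blast)
qed

lemma heisenberg_group: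
  assumes "heisenberg n G"
  shows "group G"
proof -
  note pr = proj1_add[OF assms]
  have c: "carrier G = UNIV" and o: "\<one>\<^bsub>G\<^esub> = 0"
    and m: "\<And>p q. p \<otimes>\<^bsub>G\<^esub> q = p + q + (1/2) *\<^sub>R heis_bracket G p q"
    and s: "subspace (layer2 G)" "vert G \<in> layer2 G"
    and sy: "symplectic_form_on (layer1 G) (symp G)"
    using assms by (auto simp: heisenberg_def)
  have sk: "symp G a b = - symp G b a" if "a \<in> layer1 G" "b \<in> layer1 G" for a b
    using sy that unfolding symplectic_form_on_def by blast
  have l: "symp G (a + b) z = symp G a z + symp G b z"
    if "a \<in> layer1 G" "b \<in> layer1 G" "z \<in> layer1 G" for a b z
    using sy that unfolding symplectic_form_on_def by (metis mult_1 scaleR_one)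
  have "subspace (layer1 G)" using assms by (simp add: heisenberg_def)
  then have r: "symp G z (a + b) = symp G z a + symp G z b"
    if "a \<in> layer1 G" "b \<in> layer1 G" "z \<in> layer1 G" for a b z
    using that l[of a b z] sk[of z "a + b"] sk[of z a] sk[of z b] subspace_add by fastforce
  have pm: "proj1 G (p \<otimes>\<^bsub>G\<^esub> q) = proj1 G p + proj1 G q" for p q
    using s by (simp add: m pr heis_bracket_def subspace_scale)
  have z: "symp G 0 a = 0" if "a \<in> layer1 G" for a
    using l[of 0 0 a] that pr(1)[of 0] pr(4)[of 0] s subspace_0 by fastforce
  have p0: "proj1 G 0 = 0" using pr(4)[of 0] s subspace_0 by blast
  show ?thesis
  proof (rule groupI)
    fix p q w :: 'a
    show "p \<otimes>\<^bsub>G\<^esub> q \<otimes>\<^bsub>G\<^esub> w = p \<otimes>\<^bsub>G\<^esub> (q \<otimes>\<^bsub>G\<^esub> w)"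
      unfolding m[of "p \<otimes>\<^bsub>G\<^esub> q" w] m[of p "q \<otimes>\<^bsub>G\<^esub> w"] heis_bracket_def pm
      by (simp add: l r pr(1) m heis_bracket_def scaleR_add_left scaleR_add_right algebra_simps)
    show "\<one>\<^bsub>G\<^esub> \<otimes>\<^bsub>G\<^esub> p = p" by (simp add: m o heis_bracket_def p0 z pr(1))
    have "symp G (- proj1 G p) (proj1 G p) = 0"
      using l[of "- proj1 G p" "proj1 G p" "proj1 G p"] sk[of "proj1 G p" "proj1 G p"]
        pr(1)[of p] pr(1)[of "- p"] pr(5)[of p] z by simp
    then have "(- p) \<otimes>\<^bsub>G\<^esub> p = \<one>\<^bsub>G\<^esub>" by (simp add: m o heis_bracket_def pr(5))
    then show "\<exists>y\<in>carrier G. y \<otimes>\<^bsub>G\<^esub> p = \<one>\<^bsub>G\<^esub>" using c by blast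
  qed (auto simp: c)
qed

text \<open>
  The kernel of a homomorphism \<open>L\<close> of the Heisenberg group can be an intrinsic graph over \<open>W\<close> only
  if \<open>L\<close> is injective on \<open>V\<close>. A differential of a function that is constant on the graph of \<open>\<phi>\<close>
  need not be: a constant function has the zero differential, whose kernel is the whole group.
\<close>

lemma kernel_eq_graph_imp_inj_on:
  assumes G: "heisenberg n G" and WV: "semidirect_factorization G W V"
    and L: "L \<in> hom G (additive_group :: ('b::real_vector) monoid)"
    and M: "M \<in> hom (G\<lparr>carrier := W\<rparr>) (G\<lparr>carrier := V\<rparr>)"
    and eq: "kernel G additive_group L = graph_map G M ` W"
  shows "inj_on L V"
proof (rule inj_onI)
  interpret group G using heisenberg_group[OF G] .
  have sW: "subgroup W G" and sV: "subgroup V G" and i: "W \<inter> V = {0}"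
    using WV by (auto simp: semidirect_factorization_def homogeneous_subgroup_def)
  have c: "carrier G = UNIV" and o: "\<one>\<^bsub>G\<^esub> = 0" using G by (auto simp: heisenberg_def)
  have Lm: "L (p \<otimes>\<^bsub>G\<^esub> q) = L p + L q" for p q
    using L c by (simp add: hom_def additive_group_def)
  have M0: "M 0 = 0"
    using hom_one[OF M subgroup.subgroup_is_group[OF sW] subgroup.subgroup_is_group[OF sV]]
    by (simp add: o is_group)
  fix a b assume ab: "a \<in> V" "b \<in> V" "L a = L b"
  let ?v = "inv\<^bsub>G\<^esub> a \<otimes>\<^bsub>G\<^esub> b"
  have v: "?v \<in> V" using ab sV by (simp add: subgroup.m_closed subgroup.m_inv_closed)
  have "L (inv\<^bsub>G\<^esub> a) + L a = L 0" using Lm[of "inv\<^bsub>G\<^esub> a" a] c o l_inv by simp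
  moreover have "0 \<otimes>\<^bsub>G\<^esub> 0 = 0" using l_one[of "\<one>\<^bsub>G\<^esub>"] c unfolding o by simp
  then have "L 0 = 0" using Lm[of 0 0] by simp
  ultimately have "L ?v = 0" using ab by (simp add: Lm)
  then have "?v \<in> kernel G additive_group L" by (simp add: kernel_def c additive_group_def)
  then obtain w where w: "w \<in> W" "?v = w \<otimes>\<^bsub>G\<^esub> M w" unfolding eq graph_map_def by auto
  have Mw: "M w \<in> V" using M w by (auto simp: hom_def)
  have "?v \<otimes>\<^bsub>G\<^esub> inv\<^bsub>G\<^esub> (M w) = w" using w by (simp add: inv_solve_right' c)
  then have "w \<in> V" using v Mw sV by (metis subgroup.m_closed subgroup.m_inv_closed)
  then have "w = 0" using w i by auto
  then have "?v = \<one>\<^bsub>G\<^esub>" using w M0 l_one[of "\<one>\<^bsub>G\<^esub>"] c unfolding o by simp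
  then show "a = b" by (metis UNIV_I c inv_equality inv_inv inv_closed)
qed

end

theory Submission
  imports Defs
begin

text \<open>
  Put \<open>v = \<phi> u\<close> and \<open>x = uv\<close>, and let \<open>\<psi>\<close> be the translate of \<open>\<phi>\<close> by the inverse of \<open>x\<close>. The graph
  map sends \<open>\<sigma>\<^sub>x(w)\<close> to \<open>xy\<close> with \<open>y = w \<psi>(w)\<close>, so the increment of \<open>f \<circ> \<Phi>\<close> is that of \<open>f\<close> at \<open>x\<close>
  along \<open>y\<close>. Since \<open>y\<close> differs from \<open>w d\<phi>(w)\<close> by a right factor of homogeneous norm \<open>o(\<parallel>w\<parallel>)\<close>, and
  h-homomorphisms are bounded by the homogeneous norm, the chain rule follows. Extrinsic
  differentials are unique because the small dilates of every \<open>w \<in> W\<close> lie in the domain; if \<open>f\<close> is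
  constant on the graph, the zero map is one of them.
\<close>

section \<open>Algebra of the Heisenberg group: projection, form and group law\<close>

locale heisenberg_space =
  fixes G :: "('a::euclidean_space) heis" (structure) and n :: nat
  assumes heis: "heisenberg n G"
begin

sublocale group G
  using heisenberg_group[OF heis] .

lemma carrier_UNIV [simp]: "carrier G = UNIV" and one_zero [simp]: "\<one> = 0"
  and subspace_layer1: "subspace (layer1 G)" and subspace_layer2: "subspace (layer2 G)"
  and layers_Int: "layer1 G \<inter> layer2 G = {0}"
  and vert_layer2: "vert G \<in> layer2 G" and vert_nonzero [simp]: "vert G \<noteq> 0"
  using heis by (auto simp: heisenberg_def)

lemmas proj1_layer1 = proj1_add(1)[OF heis]
lemmas proj1_layer2 = proj1_add(2)[OF heis]
lemmas proj1_plus [simp] = proj1_add(3)[OF heis]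
lemmas proj1_of_layer2 = proj1_add(4)[OF heis]
lemmas proj1_minus [simp] = proj1_add(5)[OF heis]

lemma proj1_eqI:
  assumes "a \<in> layer1 G" "p - a \<in> layer2 G"
  shows "proj1 G p = a"
proof -
  have "a - proj1 G p \<in> layer1 G"
    using assms proj1_layer1 subspace_diff[OF subspace_layer1] by blast
  moreover have "(p - proj1 G p) - (p - a) \<in> layer2 G"
    using assms proj1_layer2 subspace_diff[OF subspace_layer2] by blast
  moreover have "(p - proj1 G p) - (p - a) = a - proj1 G p" by simp
  ultimately show ?thesis using layers_Int by (metis IntI eq_iff_diff_eq_0 singletonD)
qed

lemma proj1_scaleR [simp]: "proj1 G (c *\<^sub>R p) = c *\<^sub>R proj1 G p"
proof (rule proj1_eqI)
  show "c *\<^sub>R proj1 G p \<in> layer1 G"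
    using proj1_layer1 subspace_layer1 subspace_scale by blast
  have "c *\<^sub>R (p - proj1 G p) \<in> layer2 G"
    using proj1_layer2 subspace_layer2 subspace_scale by blast
  then show "c *\<^sub>R p - c *\<^sub>R proj1 G p \<in> layer2 G" by (simp add: scaleR_diff_right)
qed

lemma linear_proj1: "linear (proj1 G)"
  by (rule linearI) simp_all

lemma proj1_diff [simp]: "proj1 G (p - q) = proj1 G p - proj1 G q"
  using linear_proj1 by (rule linear_diff)

lemma proj1_zero [simp]: "proj1 G 0 = 0"
  using linear_proj1 by (rule linear_0)

lemma proj1_of_layer1: "a \<in> layer1 G \<Longrightarrow> proj1 G a = a"
  by (rule proj1_eqI) (auto simp: subspace_0[OF subspace_layer2])

lemma proj1_proj1 [simp]: "proj1 G (proj1 G p) = proj1 G p"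
  by (simp add: proj1_of_layer1 proj1_layer1)

lemma proj1_vert [simp]: "proj1 G (vert G) = 0"
  by (simp add: proj1_of_layer2 vert_layer2)

lemma layer2_multiple:
  assumes "b \<in> layer2 G"
  obtains s where "b = s *\<^sub>R vert G"
proof -
  have "span {vert G} = layer2 G"
  proof (rule subspace_dim_equal)
    show "span {vert G} \<subseteq> layer2 G"
      using subspace_layer2 vert_layer2 by (simp add: span_minimal)
    show "dim (layer2 G) \<le> dim (span {vert G})"
      using heis by (simp add: heisenberg_def dim_singleton)
  qed (use subspace_layer2 in auto)
  then show ?thesis using assms that by (auto simp: span_singleton)
qed

text \<open>\<open>symp\<close> is constrained only on the first layer. Precomposing with
  \<open>proj1\<close> makes the form bilinear on the whole space, so that computations carry no
  membership conditions.\<close>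

definition form :: "'a \<Rightarrow> 'a \<Rightarrow> real" where
  "form p q = symp G (proj1 G p) (proj1 G q)"

lemma mult_eq: "p \<otimes> q = p + q + (form p q / 2) *\<^sub>R vert G"
proof -
  have "p \<otimes> q = p + q + (1/2) *\<^sub>R heis_bracket G p q"
    using heis unfolding heisenberg_def by blast
  then show ?thesis by (simp add: heis_bracket_def form_def)
qed

lemma symplectic: "symplectic_form_on (layer1 G) (symp G)"
  using heis unfolding heisenberg_def by blast

lemma form_skew: "form p q = - form q p"
  unfolding form_def
  using symplectic proj1_layer1[of p] proj1_layer1[of q] unfolding symplectic_form_on_def by blast

lemma form_lincomb: "form (a *\<^sub>R p + b *\<^sub>R q) r = a * form p r + b * form q r"
  unfolding form_def proj1_plus proj1_scaleR
  using symplectic proj1_layer1[of p] proj1_layer1[of q] proj1_layer1[of r]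
  unfolding symplectic_form_on_def by blast

lemma form_add_left [simp]: "form (p + q) r = form p r + form q r"
  using form_lincomb[of 1 p 1 q r] by simp

lemma form_scaleR_left [simp]: "form (a *\<^sub>R p) r = a * form p r"
  using form_lincomb[of a p 0 p r] by simp

lemma form_add_right [simp]: "form r (p + q) = form r p + form r q"
  using form_skew[of r] by simp

lemma form_scaleR_right [simp]: "form r (a *\<^sub>R p) = a * form r p"
  using form_skew[of r] by simp

lemma bilinear_form: "bilinear form"
  by (simp add: bilinear_def linear_iff)

lemma form_minus_left [simp]: "form (- p) r = - form p r"
  using form_scaleR_left[of "-1"] by simp

lemma form_minus_right [simp]: "form r (- p) = - form r p"
  using form_scaleR_right[of _ "-1"] by simp

lemma form_zero [simp]: "form 0 r = 0" "form r 0 = 0"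
  using form_scaleR_left[of 0] form_scaleR_right[of _ 0] by simp_all

lemma form_self [simp]: "form p p = 0"
  using form_skew[of p p] by linarith

lemma form_proj1 [simp]: "form (proj1 G p) q = form p q" "form p (proj1 G q) = form p q"
  by (simp_all add: form_def)

lemma form_vert [simp]: "form (vert G) q = 0" "form p (vert G) = 0"
  using form_proj1(1)[of "vert G"] form_proj1(2)[of _ "vert G"] by simp_all

text \<open>In finite dimension a bilinear map is bounded. This is what makes the group law
  continuous in the vector space topology.\<close>

lemma tendsto_form:
  "(f \<longlongrightarrow> a) F \<Longrightarrow> (g \<longlongrightarrow> b) F \<Longrightarrow> ((\<lambda>x. form (f x) (g x)) \<longlongrightarrow> form a b) F"
  using bounded_bilinear.tendsto[OF bilinear_form[unfolded bilinear_conv_bounded_bilinear]] .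

lemma tendsto_proj1 [tendsto_intros]: "(f \<longlongrightarrow> a) F \<Longrightarrow> ((\<lambda>x. proj1 G (f x)) \<longlongrightarrow> proj1 G a) F"
  using bounded_linear.tendsto linear_proj1 linear_conv_bounded_linear by blast

lemma tendsto_mult_heis [tendsto_intros]:
  "(f \<longlongrightarrow> a) F \<Longrightarrow> (g \<longlongrightarrow> b) F \<Longrightarrow> ((\<lambda>x. f x \<otimes> g x) \<longlongrightarrow> a \<otimes> b) F"
  unfolding mult_eq by (intro tendsto_intros tendsto_form) auto

lemma inv_eq: "inv p = - p"
  by (rule inv_equality) (simp_all add: mult_eq)

lemma mult_zero [simp]: "p \<otimes> 0 = p" "0 \<otimes> p = p"
  by (simp_all add: mult_eq)

lemma proj1_mult [simp]: "proj1 G (p \<otimes> q) = proj1 G p + proj1 G q"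
  by (simp add: mult_eq)

text \<open>Subgroup closure and left invariance speak of products; they reach vector sums at the
  cost of this central factor.\<close>

lemma add_eq_mult: "p + q = p \<otimes> q \<otimes> ((- form p q / 2) *\<^sub>R vert G)"
  by (simp add: mult_eq flip: scaleR_add_left)

lemma mult_layer2: "b \<in> layer2 G \<Longrightarrow> p \<otimes> b = p + b"
  by (elim layer2_multiple) (simp add: mult_eq)

section \<open>Dilations, vertical subgroups and homogeneous additive maps\<close>

lemma dilation_zero [simp]: "dilation G t 0 = 0"
  by (simp add: dilation_def)

lemma dilation_layer1: "a \<in> layer1 G \<Longrightarrow> dilation G t a = t *\<^sub>R a"
  by (simp add: dilation_def proj1_of_layer1)

lemma dilation_vert: "dilation G t (s *\<^sub>R vert G) = (t\<^sup>2 * s) *\<^sub>R vert G"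
  by (simp add: dilation_def)

lemma proj1_dilation [simp]: "proj1 G (dilation G t p) = t *\<^sub>R proj1 G p"
  by (simp add: dilation_def)

lemma dilation_mult: "dilation G t (p \<otimes> q) = dilation G t p \<otimes> dilation G t q"
proof -
  \<comment> \<open>Going through \<open>proj1\<close> exposes a factor \<open>t\<close> in each
    argument; their product is the weight with which dilations act on the second layer.\<close>
  have "form (dilation G t p) (dilation G t q) = form (proj1 G (dilation G t p)) (proj1 G (dilation G t q))"
    by (simp del: proj1_dilation)
  also have "\<dots> = t\<^sup>2 * form p q"
    by (simp add: power2_eq_square)
  finally have "form (dilation G t p) (dilation G t q) = t\<^sup>2 * form p q" .
  then show ?thesis by (simp add: mult_eq dilation_def algebra_simps)
qed

lemma dilation_eq_0_iff: "t > 0 \<Longrightarrow> dilation G t p = 0 \<longleftrightarrow> p = 0"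
proof
  assume t: "t > 0" and "dilation G t p = 0"
  then have "proj1 G p = 0" using proj1_dilation[of t p] by simp
  then show "p = 0" using t \<open>dilation G t p = 0\<close> by (simp add: dilation_def)
qed simp

text \<open>Central corrections stay inside \<open>W\<close>. A sum differs from a product by a
  central vector, and a positive multiple of \<open>p\<close> is the dilate of its first-layer part
  plus a central vector.\<close>

lemma vertical_subspace:
  assumes W: "homogeneous_subgroup W G" "layer2 G \<subseteq> W"
  shows "subspace W"
proof -
  have sg: "subgroup W G" and dil: "\<And>t p. t > 0 \<Longrightarrow> p \<in> W \<Longrightarrow> dilation G t p \<in> W"
    using W by (auto simp: homogeneous_subgroup_def)
  have add: "p + q \<in> W" if "p \<in> W" "q \<in> W" for p q
    unfolding add_eq_mult[of p q] using that W(2) vert_layer2 subspace_scale[OF subspace_layer2]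
    by (blast intro: subgroup.m_closed[OF sg])
  have neg: "- p \<in> W" if "p \<in> W" for p
    using subgroup.m_inv_closed[OF sg that] by (simp add: inv_eq)
  have pos: "c *\<^sub>R p \<in> W" if "c > 0" "p \<in> W" for c p
  proof -
    have "p + - (p - proj1 G p) \<in> W"
      using that W(2) proj1_layer2 by (blast intro: add neg)
    then have "dilation G c (proj1 G p) \<in> W" using dil that by simp
    moreover have "c *\<^sub>R (p - proj1 G p) \<in> W"
      using W(2) proj1_layer2 subspace_scale[OF subspace_layer2] by blast
    ultimately show ?thesis
      using add by (fastforce simp: dilation_layer1 proj1_layer1 scaleR_diff_right)
  qed
  show ?thesis
  proof (rule subspaceI)
    show "0 \<in> W" using subgroup.one_closed[OF sg] by simp
    fix c p assume "p \<in> W"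
    then show "c *\<^sub>R p \<in> W"
      using pos[of c p] neg[OF pos[of "- c" p]] \<open>0 \<in> W\<close> by (cases c "0::real" rule: linorder_cases) auto
  qed (rule add)
qed

lemma homogeneous_UNIV: "homogeneous_subgroup UNIV G"
  using subgroup_self by (simp add: homogeneous_subgroup_def)

text \<open>
  Homogeneity forces \<open>M\<close> to vanish on the second layer, since \<open>M (4b) = 2 M b\<close> by dilation and
  \<open>M (4b) = 4 M b\<close> by additivity. The map then descends to the first layer, where it is linear.
\<close>

lemma homogeneous_additive_linear:
  fixes M :: "'a \<Rightarrow> 'b::real_vector"
  assumes W: "homogeneous_subgroup W G" "layer2 G \<subseteq> W"
    and mult: "\<And>p q. p \<in> W \<Longrightarrow> q \<in> W \<Longrightarrow> M (p \<otimes> q) = M p + M q"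
    and dil: "\<And>t p. t > 0 \<Longrightarrow> p \<in> W \<Longrightarrow> M (dilation G t p) = t *\<^sub>R M p"
  obtains g where "linear g" "\<And>w. w \<in> W \<Longrightarrow> M w = g (proj1 G w)"
proof -
  have sW: "subspace W" using vertical_subspace[OF W] .
  have central: "M b = 0" if b: "b \<in> layer2 G" for b
  proof -
    have bW: "c *\<^sub>R b \<in> W" for c
      using b W(2) sW subspace_scale by blast
    obtain s where s: "b = s *\<^sub>R vert G" using layer2_multiple[OF b] .
    \<comment> \<open>The form vanishes on parallel vectors, so the group square of a vector is its
      double.\<close>
    have two: "M (2 *\<^sub>R (c *\<^sub>R b)) = 2 *\<^sub>R M (c *\<^sub>R b)" for c
    proof -
      have "(c *\<^sub>R b) \<otimes> (c *\<^sub>R b) = 2 *\<^sub>R (c *\<^sub>R b)"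
        unfolding mult_eq scaleR_2 by simp
      then show ?thesis using mult[OF bW bW, of c c] unfolding scaleR_2 by argo
    qed
    have "M (4 *\<^sub>R b) = 2 *\<^sub>R M b"
      using dil[of 2 b] bW[of 1] by (simp add: s dilation_vert)
    moreover have "M (4 *\<^sub>R b) = 4 *\<^sub>R M b"
      using two[of 2] two[of 1] by simp
    ultimately have "(2::real) = 4 \<or> M b = 0"
      using scaleR_cancel_right[of 2 "M b" 4] by metis
    then show ?thesis by simp
  qed
  have shift: "M (p + b) = M p" if "p \<in> W" "b \<in> layer2 G" for p b
    using that mult[of p b] central W(2) by (auto simp: mult_layer2)
  have add: "M (p + q) = M p + M q" if "p \<in> W" "q \<in> W" for p q
    using that mult[OF that] shift[of "p + q" "(form p q / 2) *\<^sub>R vert G"] vert_layer2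
    by (simp add: mult_eq subspace_add[OF sW] subspace_scale[OF subspace_layer2])
  have M0: "M 0 = 0" using central subspace_0[OF subspace_layer2] by blast
  have projW: "proj1 G p \<in> W" if "p \<in> W" for p
    using subspace_diff[OF sW that, of "p - proj1 G p"] W(2) proj1_layer2[of p] by auto
  have proj: "M p = M (proj1 G p)" if "p \<in> W" for p
    using shift[OF projW[OF that] proj1_layer2[of p]] by simp
  have neg: "M (- p) = - M p" if "p \<in> W" for p
    using minus_unique[of "M p" "M (- p)"] add[OF that subspace_neg[OF sW that]] M0 by simp
  have pos: "M (c *\<^sub>R p) = c *\<^sub>R M p" if "c > 0" "p \<in> W" for c p
  proof -
    have "M (c *\<^sub>R p) = M (proj1 G (c *\<^sub>R p))"
      using proj that by (simp add: subspace_scale[OF sW])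
    also have "\<dots> = M (dilation G c (proj1 G p))"
      by (simp add: dilation_layer1 proj1_layer1)
    also have "\<dots> = c *\<^sub>R M p"
      using dil[OF that(1) projW[OF that(2)]] proj[OF that(2)] by argo
    finally show ?thesis .
  qed
  have scale: "M (c *\<^sub>R p) = c *\<^sub>R M p" if p: "p \<in> W" for c p
  proof (cases c "0::real" rule: linorder_cases)
    case less
    then show ?thesis
      using pos[of "- c" p] neg[of "(- c) *\<^sub>R p"] p subspace_scale[OF sW p, of "- c"] by simp
  qed (use pos p M0 in auto)
  obtain B where B: "B \<subseteq> W" "independent B" "W \<subseteq> span B"
    by (rule basis_exists[of W])
  obtain g where g: "linear g" "\<And>b. b \<in> B \<Longrightarrow> g b = M b"
    using linear_independent_extend[OF B(2), of M] by blast
  \<comment> \<open>\<open>M\<close> is additive and homogeneous only on \<open>W\<close>, so the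
    span induction carries membership in \<open>W\<close> along with the equality.\<close>
  have ext: "w \<in> W \<and> g w = M w" if "w \<in> span B" for w
    using that
  proof (induction rule: span_induct_alt)
    case base
    then show ?case using M0 linear_0[OF g(1)] subspace_0[OF sW] by simp
  next
    case (step c b p)
    have b: "b \<in> W" using step(1) B(1) by blast
    have p: "p \<in> W" "g p = M p" using step(2) by auto
    have cb: "c *\<^sub>R b \<in> W" using subspace_scale[OF sW b] .
    have "M (c *\<^sub>R b + p) = g (c *\<^sub>R b + p)"
      unfolding add[OF cb p(1)] scale[OF b] linear_add[OF g(1)] linear_scale[OF g(1)]
      using g(2)[OF step(1)] p(2) by simp
    then show ?case using subspace_add[OF sW cb p(1)] by simp
  qed
  have "M w = g (proj1 G w)" if w: "w \<in> W" for w
  proof -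
    have "proj1 G w \<in> span B" using projW[OF w] B(3) by blast
    then show ?thesis using ext proj[OF w] by metis
  qed
  then show ?thesis using that[OF g(1)] by blast
qed

section \<open>A concrete gauge, homogeneous under dilations, and its unit sphere\<close>

definition quasinorm :: "'a \<Rightarrow> real" where
  "quasinorm p = norm (proj1 G p) + sqrt (norm (p - proj1 G p))"

text \<open>The square root in the gauge compensates the factor \<open>t\<^sup>2\<close> on the
  second layer, so both summands have degree one.\<close>

lemma quasinorm_dilation: "t > 0 \<Longrightarrow> quasinorm (dilation G t p) = t * quasinorm p"
proof -
  assume t: "t > 0"
  have "dilation G t p - proj1 G (dilation G t p) = t\<^sup>2 *\<^sub>R (p - proj1 G p)"
    by (simp add: dilation_def)
  then show ?thesis using t
    by (simp add: quasinorm_def real_sqrt_mult distrib_left)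
qed

lemma quasinorm_pos: "p \<noteq> 0 \<Longrightarrow> quasinorm p > 0"
  unfolding quasinorm_def
  by (cases "proj1 G p = 0") (auto intro: add_pos_nonneg)

lemma quasinorm_zero [simp]: "quasinorm 0 = 0"
  by (simp add: quasinorm_def)

lemma norm_proj1_le_quasinorm: "norm (proj1 G p) \<le> quasinorm p"
  by (simp add: quasinorm_def)

text \<open>The second-layer part enters the gauge under a square root, so recovering its Euclidean
  norm costs a square.\<close>

lemma norm_le_quasinorm: "norm p \<le> quasinorm p + (quasinorm p)\<^sup>2"
proof -
  have "norm (p - proj1 G p) = (sqrt (norm (p - proj1 G p)))\<^sup>2" by simp
  also have "\<dots> \<le> (quasinorm p)\<^sup>2" by (rule power_mono) (simp_all add: quasinorm_def)
  finally show ?thesis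
    using norm_proj1_le_quasinorm[of p] norm_triangle_sub[of p "proj1 G p"] by linarith
qed

text \<open>Continuity of the gauge gives closedness, and \<open>norm_le_quasinorm\<close> gives the
  bound \<open>1 + 1\<close>.\<close>

lemma compact_quasinorm_sphere: "compact {p. quasinorm p = 1}"
proof (rule compact_eq_bounded_closed[THEN iffD2], intro conjI)
  show "bounded {p. quasinorm p = 1}"
  proof (rule boundedI)
    show "norm p \<le> 2" if "p \<in> {p. quasinorm p = 1}" for p
      using norm_le_quasinorm[of p] that by simp
  qed
  have "isCont quasinorm p" for p
    unfolding quasinorm_def[abs_def] isCont_def by (intro tendsto_intros)
  then have "continuous_on UNIV quasinorm" by (simp add: continuous_at_imp_continuous_on)
  then show "closed {p. quasinorm p = 1}"
    using continuous_closed_vimage[of "{1}" quasinorm] \<open>\<And>p. isCont quasinorm p\<close>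
    by (simp add: vimage_def)
qed

lemma quasinorm_normalize:
  assumes "p \<noteq> 0"
  shows "quasinorm (dilation G (inverse (quasinorm p)) p) = 1"
  using quasinorm_pos[OF assms] by (simp add: quasinorm_dilation)

lemma tendsto_dilation_0: "((\<lambda>t. dilation G t p) \<longlongrightarrow> 0) (at_right 0)"
  unfolding dilation_def by (auto intro!: tendsto_eq_intros)

end

section \<open>Homogeneous distances and comparison with the vector space topology\<close>

locale homogeneous_heisenberg = heisenberg_space +
  fixes d :: "'a \<Rightarrow> 'a \<Rightarrow> real"
  assumes dist: "homogeneous_distance G d"
begin

sublocale M: Metric_space UNIV d
  using dist by (simp add: homogeneous_distance_def)

lemma dist_left_invariant: "d (r \<otimes> p) (r \<otimes> q) = d p q"
  using dist by (simp add: homogeneous_distance_def)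

abbreviation hnorm :: "'a \<Rightarrow> real" where
  "hnorm p \<equiv> d p 0"

lemma hnorm_dilation: "t > 0 \<Longrightarrow> hnorm (dilation G t p) = t * hnorm p"
  using dist dilation_zero unfolding homogeneous_distance_def by metis

lemma dist_eq_hnorm: "d p q = hnorm (- p \<otimes> q)"
proof -
  have "- p \<otimes> p = 0" by (simp add: mult_eq)
  then show ?thesis
    using dist_left_invariant[of "- p" p q] M.commute[of 0] by simp
qed

lemma hnorm_minus [simp]: "hnorm (- p) = hnorm p"
  using dist_eq_hnorm[of p 0] by simp

lemma hnorm_mult_le: "hnorm (p \<otimes> q) \<le> hnorm p + hnorm q"
  using M.triangle[of "p \<otimes> q" p 0] dist_left_invariant[of p q 0] by simp

lemma hnorm_pos: "p \<noteq> 0 \<Longrightarrow> hnorm p > 0"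
  using M.mdist_pos_less by auto

text \<open>Dilation by \<open>sqrt s\<close> multiplies a central vector by \<open>s\<close>, hence
  the square root; inversion settles negative \<open>s\<close>.\<close>

lemma hnorm_vert: "hnorm (s *\<^sub>R vert G) = sqrt \<bar>s\<bar> * hnorm (vert G)"
proof -
  have pos: "hnorm (t *\<^sub>R vert G) = sqrt t * hnorm (vert G)" if "t > 0" for t
    using hnorm_dilation[of "sqrt t" "vert G"] dilation_vert[of "sqrt t" 1] that by simp
  show ?thesis
    using pos[of s] pos[of "- s"] hnorm_minus[of "s *\<^sub>R vert G"]
    by (cases s "0::real" rule: linorder_cases) auto
qed

lemma hnorm_layer1:
  assumes "a \<in> layer1 G"
  shows "hnorm (s *\<^sub>R a) = \<bar>s\<bar> * hnorm a"
proof -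
  have pos: "hnorm (t *\<^sub>R a) = t * hnorm a" if "t > 0" for t
    using hnorm_dilation[OF that, of a] assms by (simp add: dilation_layer1)
  show ?thesis
    using pos[of s] pos[of "- s"] hnorm_minus[of "s *\<^sub>R a"]
    by (cases s "0::real" rule: linorder_cases) auto
qed

text \<open>The triangle inequality holds for products. The last term is the norm of the central
  factor that turns the product into the sum.\<close>

lemma hnorm_add_le: "hnorm (p + q) \<le> hnorm p + hnorm q + sqrt \<bar>form p q / 2\<bar> * hnorm (vert G)"
proof -
  have "hnorm (p + q) \<le> hnorm (p \<otimes> q) + hnorm ((- form p q / 2) *\<^sub>R vert G)"
    unfolding add_eq_mult[of p q] by (rule hnorm_mult_le)
  also have "hnorm ((- form p q / 2) *\<^sub>R vert G) = sqrt \<bar>form p q / 2\<bar> * hnorm (vert G)"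
    unfolding hnorm_vert by simp
  finally show ?thesis using hnorm_mult_le[of p q] by linarith
qed

text \<open>The hypothesis on the form makes the central correction between sum and product
  disappear in the limit.\<close>

lemma tendsto_hnorm_add:
  assumes "((\<lambda>w. hnorm (f w)) \<longlongrightarrow> 0) F" "((\<lambda>w. hnorm (g w)) \<longlongrightarrow> 0) F"
    and "((\<lambda>w. form (f w) (g w)) \<longlongrightarrow> 0) F"
  shows "((\<lambda>w. hnorm (f w + g w)) \<longlongrightarrow> 0) F"
proof (rule tendsto_sandwich[OF _ _ tendsto_const])
  show "((\<lambda>w. hnorm (f w) + hnorm (g w) + sqrt \<bar>form (f w) (g w) / 2\<bar> * hnorm (vert G)) \<longlongrightarrow> 0) F"
    using assms by (auto intro!: tendsto_eq_intros)
qed (use hnorm_add_le in \<open>auto intro!: always_eventually simp del: real_sqrt_divide abs_divide\<close>)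

text \<open>
  The distance is not assumed continuous; writing \<open>w\<close> as a sum of multiples of finitely many fixed
  vectors and correcting by central terms bounds \<open>hnorm w\<close> in the coordinates of \<open>w\<close>.
\<close>

lemma isCont_hnorm_0: "isCont hnorm 0"
proof -
  \<comment> \<open>Projecting each vector puts every term in the first layer, where the norm scales
    linearly. An arbitrary finite set stands in for \<open>Basis\<close> to allow induction.\<close>
  have sum: "((\<lambda>w. hnorm (\<Sum>i\<in>B. (w \<bullet> i) *\<^sub>R proj1 G i)) \<longlongrightarrow> 0) (at 0)"
    if "finite B" for B :: "'a set"
    using that
  proof (induction B)
    case (insert j B)
    have "((\<lambda>w. \<bar>w \<bullet> j\<bar> * hnorm (proj1 G j)) \<longlongrightarrow> 0) (at 0)"
      by (auto intro!: tendsto_eq_intros)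
    then have "((\<lambda>w. hnorm ((w \<bullet> j) *\<^sub>R proj1 G j)) \<longlongrightarrow> 0) (at 0)"
      by (simp add: hnorm_layer1 proj1_layer1)
    moreover have "((\<lambda>w. form ((w \<bullet> j) *\<^sub>R proj1 G j) (\<Sum>i\<in>B. (w \<bullet> i) *\<^sub>R proj1 G i)) \<longlongrightarrow>
        form ((0 \<bullet> j) *\<^sub>R proj1 G j) (\<Sum>i\<in>B. (0 \<bullet> i) *\<^sub>R proj1 G i)) (at 0)"
      by (intro tendsto_form tendsto_intros)
    ultimately show ?case
      using insert by (simp add: tendsto_hnorm_add del: form_scaleR_left form_proj1)
  qed simp
  \<comment> \<open>Basis vectors need not lie in a layer; linearity of \<open>proj1\<close>
    recovers the first-layer part of \<open>w\<close> from the whole expansion.\<close>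
  have proj: "(\<Sum>i\<in>Basis. (w \<bullet> i) *\<^sub>R proj1 G i) = proj1 G w" for w
    using arg_cong[OF euclidean_representation[of w], of "proj1 G"]
    by (simp add: linear_sum[OF linear_proj1])
  have vertical: "((\<lambda>w. hnorm (w - proj1 G w)) \<longlongrightarrow> 0) (at 0)"
  proof -
    have "hnorm (w - proj1 G w) = sqrt (norm (w - proj1 G w)) * (hnorm (vert G) / sqrt (norm (vert G)))" for w
    proof -
      obtain s where "w - proj1 G w = s *\<^sub>R vert G"
        using layer2_multiple[OF proj1_layer2] .
      then show ?thesis by (simp add: hnorm_vert real_sqrt_mult)
    qed
    moreover have "((\<lambda>w. sqrt (norm (w - proj1 G w)) * (hnorm (vert G) / sqrt (norm (vert G)))) \<longlongrightarrow>
        sqrt (norm (0 - proj1 G 0)) * (hnorm (vert G) / sqrt (norm (vert G)))) (at 0)"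
      by (intro tendsto_intros) simp
    ultimately show ?thesis by simp
  qed
  have "form (proj1 G w) (w - proj1 G w) = 0" for w
    using form_proj1(2)[of "proj1 G w" "w - proj1 G w"] by simp
  then have "((\<lambda>w. hnorm (proj1 G w + (w - proj1 G w))) \<longlongrightarrow> 0) (at 0)"
    using sum[of Basis] vertical by (intro tendsto_hnorm_add) (simp_all add: proj)
  then show ?thesis by (simp add: isCont_def)
qed

lemma tendsto_hnorm_0: "(g \<longlongrightarrow> 0) F \<Longrightarrow> ((\<lambda>w. hnorm (g w)) \<longlongrightarrow> 0) F"
  using isCont_tendsto_compose[OF isCont_hnorm_0] by fastforce

text \<open>Left invariance transports continuity from 0: the norms at \<open>p\<close> and
  \<open>q\<close> differ by at most the norm of \<open>- p \<otimes> q\<close>, which tends to 0 as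
  \<open>q\<close> tends to \<open>p\<close>.\<close>

lemma isCont_hnorm: "isCont hnorm p"
  unfolding isCont_def
proof (rule LIM_zero_cancel, rule Lim_null_comparison)
  show "((\<lambda>q. hnorm (- p \<otimes> q)) \<longlongrightarrow> 0) (at p)"
  proof (rule tendsto_hnorm_0)
    have "((\<lambda>q. - p \<otimes> q) \<longlongrightarrow> - p \<otimes> p) (at p)" by (intro tendsto_intros)
    then show "((\<lambda>q. - p \<otimes> q) \<longlongrightarrow> 0) (at p)" by (simp add: mult_eq)
  qed
  have "norm (hnorm q - hnorm p) \<le> hnorm (- p \<otimes> q)" for q
    using M.triangle[of p q 0] M.triangle[of q p 0] M.commute[of q p] dist_eq_hnorm[of p q]
    by (simp add: abs_le_iff)
  then show "\<forall>\<^sub>F q in at p. norm (hnorm q - hnorm p) \<le> hnorm (- p \<otimes> q)" by simp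
qed

text \<open>The constants are the extrema of \<open>hnorm\<close> on the compact unit sphere of the
  gauge; the minimum is positive because the sphere avoids 0. Both functions have degree one under
  dilations, which extends the bounds to all points.\<close>

lemma hnorm_quasinorm_equivalent:
  obtains m K where "m > 0" "\<And>p. m * quasinorm p \<le> hnorm p" "\<And>p. hnorm p \<le> K * quasinorm p"
proof -
  let ?S = "{p. quasinorm p = 1}"
  have cont: "continuous_on ?S hnorm"
    using isCont_hnorm by (simp add: continuous_at_imp_continuous_on)
  have ne: "?S \<noteq> {}" using quasinorm_normalize[OF vert_nonzero] by blast
  obtain a where a: "a \<in> ?S" "\<And>p. p \<in> ?S \<Longrightarrow> hnorm a \<le> hnorm p"
    using continuous_attains_inf[OF compact_quasinorm_sphere ne cont] by blast
  obtain b where b: "b \<in> ?S" "\<And>p. p \<in> ?S \<Longrightarrow> hnorm p \<le> hnorm b"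
    using continuous_attains_sup[OF compact_quasinorm_sphere ne cont] by blast
  have "hnorm a * quasinorm p \<le> hnorm p \<and> hnorm p \<le> hnorm b * quasinorm p" for p
  proof (cases "p = 0")
    case False
    note q = quasinorm_pos[OF False]
    let ?p = "dilation G (inverse (quasinorm p)) p"
    have "?p \<in> ?S" using quasinorm_normalize[OF False] by simp
    then have "hnorm a \<le> hnorm ?p" "hnorm ?p \<le> hnorm b" using a b by blast+
    moreover have "hnorm ?p = hnorm p / quasinorm p"
      using q by (simp add: hnorm_dilation divide_inverse mult.commute)
    ultimately have "hnorm a \<le> hnorm p / quasinorm p" "hnorm p / quasinorm p \<le> hnorm b"
      by simp_all
    then show ?thesis using q by (simp add: pos_le_divide_eq pos_divide_le_eq)
  qed simp
  moreover have "hnorm a > 0" using a(1) hnorm_pos[of a] by fastforce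
  ultimately show ?thesis using that by blast
qed

text \<open>Converse of \<open>tendsto_hnorm_0\<close>: the Euclidean norm is bounded by a
  polynomial without constant term in \<open>hnorm\<close>.\<close>

lemma tendsto_0_if_hnorm:
  assumes "((\<lambda>w. hnorm (g w)) \<longlongrightarrow> 0) F"
  shows "(g \<longlongrightarrow> 0) F"
proof -
  obtain m K where m: "m > 0" "\<And>p. m * quasinorm p \<le> hnorm p"
    and "\<And>p. hnorm p \<le> K * quasinorm p"
    by (rule hnorm_quasinorm_equivalent) blast
  have bound: "norm p \<le> hnorm p / m + (hnorm p / m)\<^sup>2" for p
  proof -
    have q: "quasinorm p \<le> hnorm p / m"
      using m(1) m(2)[of p] by (simp add: pos_le_divide_eq mult.commute)
    moreover have "(quasinorm p)\<^sup>2 \<le> (hnorm p / m)\<^sup>2"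
      by (rule power_mono[OF q]) (simp add: quasinorm_def)
    ultimately show ?thesis using norm_le_quasinorm[of p] by linarith
  qed
  have "((\<lambda>w. hnorm (g w) / m + (hnorm (g w) / m)\<^sup>2) \<longlongrightarrow> 0 / m + (0 / m)\<^sup>2) F"
    using m(1) by (intro tendsto_intros assms) simp_all
  then have lim: "((\<lambda>w. hnorm (g w) / m + (hnorm (g w) / m)\<^sup>2) \<longlongrightarrow> 0) F" by simp
  show ?thesis
    by (rule Lim_null_comparison[OF always_eventually lim]) (use bound in blast)
qed

text \<open>Only the first-layer part is seen by the map, and there the gauge dominates the
  Euclidean norm itself, so the bound is linear in \<open>hnorm\<close>.\<close>

lemma linear_proj1_bounded:
  fixes g :: "'a \<Rightarrow> 'b::real_normed_vector"
  assumes "linear g"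
  obtains C where "C \<ge> 0" "\<And>p. norm (g (proj1 G p)) \<le> C * hnorm p"
proof -
  obtain m K where m: "m > 0" "\<And>p. m * quasinorm p \<le> hnorm p"
    and "\<And>p. hnorm p \<le> K * quasinorm p"
    by (rule hnorm_quasinorm_equivalent) blast
  obtain B where B: "B > 0" "\<And>p. norm (g p) \<le> B * norm p"
    using linear_bounded_pos[OF assms] by blast
  have "norm (g (proj1 G p)) \<le> B / m * hnorm p" for p
  proof -
    have "norm (g (proj1 G p)) \<le> B * norm (proj1 G p)" using B(2) .
    also have "\<dots> \<le> B * (hnorm p / m)"
    proof (rule mult_left_mono)
      have "m * norm (proj1 G p) \<le> hnorm p"
        using mult_left_mono[OF norm_proj1_le_quasinorm, of m p] m by (meson less_imp_le order_trans)
      then show "norm (proj1 G p) \<le> hnorm p / m"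
        using m(1) by (simp add: pos_le_divide_eq mult.commute)
    qed (use B in simp)
    finally show ?thesis by simp
  qed
  then show ?thesis using that[of "B / m"] B(1) m(1) by simp
qed

text \<open>Serves both differentials in the chain rule: \<open>S = UNIV\<close> for that of
  \<open>f\<close>, and \<open>S = W\<close> for that of \<open>\<phi>\<close>, regarded as a map
  into the vector space.\<close>

lemma homogeneous_additive_bounded:
  fixes L :: "'a \<Rightarrow> 'b::real_normed_vector"
  assumes "homogeneous_subgroup S G" "layer2 G \<subseteq> S"
    and "\<And>p q. p \<in> S \<Longrightarrow> q \<in> S \<Longrightarrow> L (p \<otimes> q) = L p + L q"
    and "\<And>t p. t > 0 \<Longrightarrow> p \<in> S \<Longrightarrow> L (dilation G t p) = t *\<^sub>R L p"
  obtains C where "C \<ge> 0" "\<And>p. p \<in> S \<Longrightarrow> norm (L p) \<le> C * hnorm p"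
proof -
  obtain g where g: "linear g" "\<And>w. w \<in> S \<Longrightarrow> L w = g (proj1 G w)"
    using homogeneous_additive_linear[where W = S and M = L, OF assms] by blast
  obtain C where "C \<ge> 0" "\<And>p. norm (g (proj1 G p)) \<le> C * hnorm p"
    using linear_proj1_bounded[OF g(1)] by blast
  then show ?thesis using that[of C] g(2) by simp
qed

end

section \<open>h-homomorphisms and semidirect factorizations\<close>

lemma h_hom_additiveD:
  assumes "L \<in> h_hom (G\<lparr>carrier := W\<rparr>) (dilation G) additive_group (*\<^sub>R)"
  shows "\<And>p q. p \<in> W \<Longrightarrow> q \<in> W \<Longrightarrow> L (p \<otimes>\<^bsub>G\<^esub> q) = L p + L q"
    and "\<And>t p. t > 0 \<Longrightarrow> p \<in> W \<Longrightarrow> L (dilation G t p) = t *\<^sub>R L p"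
  using assms by (simp_all add: h_hom_def hom_def additive_group_def)

lemma h_hom_additiveI:
  assumes "\<And>p q. p \<in> W \<Longrightarrow> q \<in> W \<Longrightarrow> L (p \<otimes>\<^bsub>G\<^esub> q) = L p + L q"
    and "\<And>t p. t > 0 \<Longrightarrow> p \<in> W \<Longrightarrow> L (dilation G t p) = t *\<^sub>R L p"
  shows "L \<in> h_hom (G\<lparr>carrier := W\<rparr>) (dilation G) additive_group (*\<^sub>R)"
  using assms by (simp add: h_hom_def hom_def additive_group_def)

lemma eventually_at_withinI: "(\<And>w. w \<in> S \<Longrightarrow> w \<noteq> a \<Longrightarrow> P w) \<Longrightarrow> eventually P (at a within S)"
  by (simp add: eventually_at_filter)

locale heisenberg_factorization = homogeneous_heisenberg +
  fixes W V :: "'a set"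
  assumes factorization: "semidirect_factorization G W V"
begin

lemma homogeneous_W: "homogeneous_subgroup W G"
  and layer2_W: "layer2 G \<subseteq> W"
  and homogeneous_V: "homogeneous_subgroup V G"
  and V_layer1: "V \<subseteq> layer1 G"
  and WV_UNIV: "W <#> V = UNIV"
  and WV_Int: "W \<inter> V = {0}"
  using factorization unfolding semidirect_factorization_def carrier_UNIV by blast+

lemma subspace_W: "subspace W"
  using vertical_subspace[OF homogeneous_W layer2_W] .

lemma subgroup_V: "subgroup V G"
  using homogeneous_V by (simp add: homogeneous_subgroup_def)

lemma dilation_W: "t > 0 \<Longrightarrow> w \<in> W \<Longrightarrow> dilation G t w \<in> W"
  using homogeneous_W by (simp add: homogeneous_subgroup_def)

lemma mult_V: "p \<in> V \<Longrightarrow> q \<in> V \<Longrightarrow> p \<otimes> q \<in> V"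
  using subgroup.m_closed[OF subgroup_V] .

lemma minus_V: "v \<in> V \<Longrightarrow> - v \<in> V"
  using subgroup.m_inv_closed[OF subgroup_V] by (simp add: inv_eq)

lemma proj1_V: "v \<in> V \<Longrightarrow> proj1 G v = v"
  using V_layer1 proj1_of_layer1 by blast

text \<open>The product lies in \<open>V\<close>, hence in the first layer, so it equals its own
  projection, from which the central term is gone: \<open>V\<close> is isotropic.\<close>

lemma mult_V_eq_add:
  assumes "p \<in> V" "q \<in> V"
  shows "p \<otimes> q = p + q"
  using proj1_V[OF mult_V[OF assms]] proj1_V[OF assms(1)] proj1_V[OF assms(2)] by simp

text \<open>A subspace containing the second layer is a union of fibres of \<open>proj1\<close>.
  Membership of a product in \<open>W\<close> can thus be tested modulo the centre, where the group
  law is addition.\<close>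

lemma W_proj1_cong:
  assumes "w \<in> W" "proj1 G q = proj1 G w"
  shows "q \<in> W"
proof -
  have "q - w \<in> layer2 G" using proj1_layer2[of "q - w"] assms(2) by simp
  then have "w + (q - w) \<in> W" using assms(1) layer2_W subspace_add[OF subspace_W] by blast
  then show ?thesis by simp
qed

text \<open>Projecting the equation to the first layer shows that \<open>v - v'\<close> equals
  \<open>proj1 G (w' - w)\<close>, so it lies in both \<open>V\<close> and \<open>W\<close>.\<close>

lemma factor_unique:
  assumes "w \<in> W" "w' \<in> W" "v \<in> V" "v' \<in> V" and eq: "w \<otimes> v = w' \<otimes> v'"
  shows "w = w' \<and> v = v'"
proof -
  have "proj1 G w + v = proj1 G w' + v'"
    using arg_cong[OF eq, of "proj1 G"] proj1_V[OF assms(3)] proj1_V[OF assms(4)]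
    unfolding proj1_mult by argo
  then have "(proj1 G w + v) - (proj1 G w + v') = (proj1 G w' + v') - (proj1 G w + v')"
    by (rule arg_cong)
  then have *: "v - v' = proj1 G (w' - w)" by simp
  have "v - v' \<in> V"
    using mult_V[OF assms(3) minus_V[OF assms(4)]] mult_V_eq_add[OF assms(3) minus_V[OF assms(4)]]
    by simp
  moreover have "v - v' \<in> W"
    by (rule W_proj1_cong[OF subspace_diff[OF subspace_W assms(2,1)]]) (simp only: * proj1_proj1)
  ultimately have "v - v' = 0" using WV_Int by blast
  then have "v = v'" by simp
  then show ?thesis using eq right_cancel[of v w w'] by simp
qed

lemma projV_mult:
  assumes "w \<in> W" "v \<in> V"
  shows "projV G W V (w \<otimes> v) = v"
  unfolding projV_def
proof (rule the_equality)
  show "v' = v" if "v' \<in> V \<and> (\<exists>w'\<in>W. w \<otimes> v = w' \<otimes> v')" for v'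
    using that factor_unique[OF assms(1) _ assms(2), of _ v'] by metis
qed (use assms in blast)

lemma projW_mult:
  assumes "w \<in> W" "v \<in> V"
  shows "projW G W V (w \<otimes> v) = w"
  unfolding projW_def
proof (rule the_equality)
  show "w' = w" if "w' \<in> W \<and> (\<exists>v'\<in>V. w \<otimes> v = w' \<otimes> v')" for w'
    using that factor_unique[OF assms(1) _ assms(2), of w'] by metis
qed (use assms in blast)

lemma mult_inv_cancel: "p \<otimes> (inv p \<otimes> q) = q" "inv p \<otimes> (p \<otimes> q) = q"
  by (simp_all flip: m_assoc)

text \<open>The inverse of \<open>w \<otimes> v\<close> is a conjugate of \<open>inv w\<close>
  followed by \<open>inv v\<close>, and the conjugate stays in \<open>W\<close> because modulo the
  centre it is just \<open>- w\<close>.\<close>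

lemma projV_inv_mult:
  assumes "w \<in> W" "v \<in> V"
  shows "projV G W V (inv (w \<otimes> v)) = inv v"
proof -
  have "inv (w \<otimes> v) \<otimes> v \<in> W"
    using subspace_neg[OF subspace_W assms(1)]
    by (rule W_proj1_cong) (simp add: inv_eq)
  then have "projV G W V ((inv (w \<otimes> v) \<otimes> v) \<otimes> inv v) = inv v"
    using minus_V[OF assms(2)] by (intro projV_mult) (simp_all add: inv_eq)
  then show ?thesis by (simp add: m_assoc)
qed

section \<open>The maps \<open>\<sigma>\<close>, the graph map and homomorphisms into
  \<open>V\<close>\<close>

lemma sigma_eq:
  assumes "u \<in> W" "v \<in> V"
  shows "sigma G W V (u \<otimes> v) w = u \<otimes> v \<otimes> w \<otimes> inv v"
    and "sigma G W V (inv (u \<otimes> v)) w = inv (u \<otimes> v) \<otimes> w \<otimes> v"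
  using assms by (simp_all add: sigma_def projV_mult projV_inv_mult)

lemma sigma_W:
  assumes "u \<in> W" "v \<in> V" "w \<in> W"
  shows "sigma G W V (u \<otimes> v) w \<in> W"
  using subspace_add[OF subspace_W assms(1,3)]
  by (rule W_proj1_cong) (simp add: sigma_eq[OF assms(1,2)], simp add: inv_eq)

lemma sigma_inv_W:
  assumes "u \<in> W" "v \<in> V" "w \<in> W"
  shows "sigma G W V (inv (u \<otimes> v)) w \<in> W"
  using subspace_diff[OF subspace_W assms(3,1)]
  by (rule W_proj1_cong) (simp add: sigma_eq[OF assms(1,2)], simp add: inv_eq)

lemma sigma_inverse:
  assumes "u \<in> W" "v \<in> V"
  shows "sigma G W V (u \<otimes> v) (sigma G W V (inv (u \<otimes> v)) w) = w"
    and "sigma G W V (inv (u \<otimes> v)) (sigma G W V (u \<otimes> v) w) = w"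
proof -
  have "(u \<otimes> v) \<otimes> (inv (u \<otimes> v) \<otimes> w \<otimes> v) \<otimes> inv v = (u \<otimes> v) \<otimes> (inv (u \<otimes> v) \<otimes> (w \<otimes> (v \<otimes> inv v)))"
    by (simp only: m_assoc carrier_UNIV UNIV_I)
  then show "sigma G W V (u \<otimes> v) (sigma G W V (inv (u \<otimes> v)) w) = w"
    by (simp add: sigma_eq[OF assms] mult_inv_cancel)
  have "inv (u \<otimes> v) \<otimes> ((u \<otimes> v) \<otimes> w \<otimes> inv v) \<otimes> v = inv (u \<otimes> v) \<otimes> ((u \<otimes> v) \<otimes> (w \<otimes> (inv v \<otimes> v)))"
    by (simp only: m_assoc carrier_UNIV UNIV_I)
  then show "sigma G W V (inv (u \<otimes> v)) (sigma G W V (u \<otimes> v) w) = w"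
    by (simp add: sigma_eq[OF assms] mult_inv_cancel)
qed

text \<open>All limits run over the image of \<open>U\<close>. The description on the right supplies
  what the estimates use: points of the domain lie in \<open>W\<close> and are sent back into
  \<open>U\<close>.\<close>

lemma sigma_image:
  assumes "u \<in> W" "v \<in> V" "U \<subseteq> W"
  shows "sigma G W V (inv (u \<otimes> v)) ` U = {w \<in> W. sigma G W V (u \<otimes> v) w \<in> U}"
proof (intro subset_antisym subsetI)
  fix w assume "w \<in> sigma G W V (inv (u \<otimes> v)) ` U"
  then obtain p where p: "p \<in> U" "w = sigma G W V (inv (u \<otimes> v)) p" by blast
  have "sigma G W V (u \<otimes> v) w = p"
    unfolding p(2) by (rule sigma_inverse(1)[OF assms(1,2)])
  moreover have "w \<in> W"
    unfolding p(2) using p(1) assms(3) by (intro sigma_inv_W[OF assms(1,2)]) blast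
  ultimately show "w \<in> {w \<in> W. sigma G W V (u \<otimes> v) w \<in> U}"
    using p(1) by blast
next
  fix w assume "w \<in> {w \<in> W. sigma G W V (u \<otimes> v) w \<in> U}"
  then have "sigma G W V (u \<otimes> v) w \<in> U" by blast
  then have "sigma G W V (inv (u \<otimes> v)) (sigma G W V (u \<otimes> v) w) \<in> sigma G W V (inv (u \<otimes> v)) ` U"
    by (rule imageI)
  then show "w \<in> sigma G W V (inv (u \<otimes> v)) ` U"
    unfolding sigma_inverse(2)[OF assms(1,2)] .
qed

text \<open>Pure reassociation: the trailing \<open>inv v\<close> of \<open>\<sigma>\<close> is the
  factor with which the translate of \<open>\<phi>\<close> begins.\<close>

lemma graph_map_sigma:
  assumes "u \<in> W" "v \<in> V"
  shows "graph_map G \<phi> (sigma G W V (u \<otimes> v) w)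
    = (u \<otimes> v) \<otimes> (w \<otimes> intrinsic_translate G W V \<phi> (inv (u \<otimes> v)) w)"
proof -
  have "inv (inv (u \<otimes> v)) = u \<otimes> v" by (simp add: inv_inv)
  then show ?thesis
    unfolding graph_map_def intrinsic_translate_def projV_inv_mult[OF assms]
    by (simp add: sigma_eq[OF assms] m_assoc)
qed

text \<open>On \<open>V\<close> the product is addition and dilations are scalar multiplication, so
  a homomorphism into \<open>V\<close> can be treated as a homogeneous additive map into a vector
  space.\<close>

lemma h_hom_VD:
  assumes "M \<in> h_hom (G\<lparr>carrier := W\<rparr>) (dilation G) (G\<lparr>carrier := V\<rparr>) (dilation G)"
  shows "\<And>p. p \<in> W \<Longrightarrow> M p \<in> V"
    and "\<And>p q. p \<in> W \<Longrightarrow> q \<in> W \<Longrightarrow> M (p \<otimes> q) = M p + M q"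
    and "\<And>t p. t > 0 \<Longrightarrow> p \<in> W \<Longrightarrow> M (dilation G t p) = t *\<^sub>R M p"
proof -
  show V: "M p \<in> V" if "p \<in> W" for p
    using assms that by (auto simp: h_hom_def hom_def)
  show "M (p \<otimes> q) = M p + M q" if "p \<in> W" "q \<in> W" for p q
    using assms that mult_V_eq_add[OF V[OF that(1)] V[OF that(2)]]
    by (simp add: h_hom_def hom_def)
  show "M (dilation G t p) = t *\<^sub>R M p" if "t > 0" "p \<in> W" for t p
    using assms that V[OF that(2)] V_layer1 by (auto simp: h_hom_def dilation_layer1)
qed

text \<open>Elements of \<open>V\<close> have no second-layer part, so the gauge is the Euclidean
  norm there. Taking \<open>max K 0\<close> secures the sign of the constant.\<close>

lemma hnorm_V_le:
  obtains K where "K \<ge> 0" "\<And>v. v \<in> V \<Longrightarrow> hnorm v \<le> K * norm v"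
proof -
  obtain m K where "m > 0" "\<And>p. m * quasinorm p \<le> hnorm p"
    and K: "\<And>p. hnorm p \<le> K * quasinorm p"
    by (rule hnorm_quasinorm_equivalent) blast
  have "hnorm v \<le> max K 0 * norm v" if "v \<in> V" for v
  proof -
    have "hnorm v \<le> K * norm v" using K[of v] proj1_V[OF that] by (simp add: quasinorm_def)
    also have "\<dots> \<le> max K 0 * norm v" by (simp add: mult_right_mono)
    finally show ?thesis .
  qed
  then show ?thesis using that[of "max K 0"] by simp
qed

section \<open>Uniqueness of the extrinsic differential\<close>

lemma filterlim_dilation:
  assumes "u \<in> W" "v \<in> V" "openin (top_of_set W) U" "u \<in> U" "w \<in> W" "w \<noteq> 0"
  shows "filterlim (\<lambda>t. dilation G t w) (at 0 within sigma G W V (inv (u \<otimes> v)) ` U) (at_right 0)"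
  unfolding filterlim_at
proof
  show "((\<lambda>t. dilation G t w) \<longlongrightarrow> 0) (at_right 0)" by (rule tendsto_dilation_0)
  obtain T where T: "open T" "U = W \<inter> T" using assms(3) by (auto simp: openin_open)
  \<comment> \<open>The image of the dilate under \<open>\<sigma>\<close> tends to the image of 0,
    which is \<open>u\<close>. Since \<open>U\<close> is relatively open, it lies in
    \<open>U\<close> for small \<open>t\<close>.\<close>
  have "((\<lambda>t. u \<otimes> v \<otimes> dilation G t w \<otimes> inv v) \<longlongrightarrow> u \<otimes> v \<otimes> 0 \<otimes> inv v) (at_right 0)"
    by (intro tendsto_intros tendsto_dilation_0)
  moreover have "u \<otimes> v \<otimes> 0 \<otimes> inv v = u" by (simp add: m_assoc)
  ultimately have "\<forall>\<^sub>F t in at_right 0. sigma G W V (u \<otimes> v) (dilation G t w) \<in> T"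
    using topological_tendstoD T assms(4) by (fastforce simp: sigma_eq[OF assms(1,2)])
  moreover have "\<forall>\<^sub>F t::real in at_right 0. t > 0" by (simp add: eventually_at_right_less)
  ultimately show "\<forall>\<^sub>F t in at_right 0. dilation G t w \<in> sigma G W V (inv (u \<otimes> v)) ` U \<and> dilation G t w \<noteq> 0"
  proof eventually_elim
    case (elim t)
    have "U \<subseteq> W" using T by blast
    then show ?case
      using elim dilation_W[OF elim(2) assms(5)] sigma_W[OF assms(1,2)] assms(6)
      by (simp add: sigma_image[OF assms(1,2)] dilation_eq_0_iff T(2))
  qed
qed

text \<open>Along the dilates of a nonzero \<open>w\<close> both error quotients tend to 0, while
  the quotient of \<open>L1 - L2\<close> by \<open>hnorm\<close> does not depend on
  \<open>t\<close>, numerator and denominator having degree one. That constant is therefore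
  0.\<close>

lemma has_extrinsic_derivative_unique:
  assumes U: "u \<in> W" "v \<in> V" "openin (top_of_set W) U" "u \<in> U"
    and L1: "has_extrinsic_derivative G d W V U F (u \<otimes> v) L1"
    and L2: "has_extrinsic_derivative G d W V U F (u \<otimes> v) L2"
    and w: "w \<in> W"
  shows "L1 w = L2 w"
proof (cases "w = 0")
  case True
  \<comment> \<open>Dilates of 0 never leave 0, which the limit excludes; additivity alone fixes the
    value.\<close>
  have "L 0 = 0" if "has_extrinsic_derivative G d W V U F (u \<otimes> v) L" for L
    using h_hom_additiveD(1)[where L = L and G = G and W = W and p = 0 and q = 0] that subspace_0[OF subspace_W]
    by (simp add: has_extrinsic_derivative_def)
  from this[OF L1] this[OF L2] show ?thesis using True by simp
next
  case False
  let ?S = "sigma G W V (inv (u \<otimes> v)) ` U"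
  let ?q = "\<lambda>L w. norm (F (sigma G W V (u \<otimes> v) w) - F (projW G W V (u \<otimes> v)) - L w) / hnorm w"
  have lim: "((\<lambda>t. ?q L (dilation G t w)) \<longlongrightarrow> 0) (at_right 0)"
    if "has_extrinsic_derivative G d W V U F (u \<otimes> v) L" for L
    using that filterlim_compose[OF _ filterlim_dilation[OF U w False], of "?q L"]
    by (simp add: has_extrinsic_derivative_def)
  have hom: "L (dilation G t w) = t *\<^sub>R L w"
    if "has_extrinsic_derivative G d W V U F (u \<otimes> v) L" "t > 0" for L t
    using that h_hom_additiveD(2)[where L = L and G = G and W = W] w by (simp add: has_extrinsic_derivative_def)
  have "((\<lambda>t. norm (L1 w - L2 w) / hnorm w) \<longlongrightarrow> 0) (at_right (0::real))"
  proof (rule Lim_null_comparison)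
    show "((\<lambda>t. ?q L1 (dilation G t w) + ?q L2 (dilation G t w)) \<longlongrightarrow> 0) (at_right 0)"
      using tendsto_add[OF lim[OF L1] lim[OF L2]] by simp
    have "norm (norm (L1 w - L2 w) / hnorm w) \<le> ?q L1 (dilation G t w) + ?q L2 (dilation G t w)"
      if t: "t > 0" for t
    proof -
      have "norm (L1 w - L2 w) / hnorm w = norm (L1 (dilation G t w) - L2 (dilation G t w)) / hnorm (dilation G t w)"
        using t by (simp add: hom[OF L1] hom[OF L2] hnorm_dilation flip: scaleR_diff_right)
      also have "\<dots> \<le> ?q L1 (dilation G t w) + ?q L2 (dilation G t w)"
        unfolding add_divide_distrib[symmetric]
      proof (rule divide_right_mono)
        show "norm (L1 p - L2 p) \<le> norm (a - b - L1 p) + norm (a - b - L2 p)" for a b p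
          using norm_triangle_ineq4[of "a - b - L2 p" "a - b - L1 p"] by (simp add: algebra_simps)
      qed simp
      finally show ?thesis by simp
    qed
    then show "\<forall>\<^sub>F t in at_right 0. norm (norm (L1 w - L2 w) / hnorm w)
        \<le> ?q L1 (dilation G t w) + ?q L2 (dilation G t w)"
      using eventually_at_right_less[of "0::real"] by (auto elim: eventually_mono)
  qed
  then have "norm (L1 w - L2 w) / hnorm w = 0"
    by (simp add: tendsto_const_iff)
  then show ?thesis using hnorm_pos[OF False] by simp
qed

section \<open>The chain rule along the graph\<close>

lemma chain_rule:
  fixes f :: "'a \<Rightarrow> 'b::real_normed_vector"
  assumes U: "U \<subseteq> W" "u \<in> U" and \<phi>: "\<phi> \<in> U \<rightarrow> V" "graph_map G \<phi> ` U \<subseteq> \<Omega>"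
    and L: "has_h_derivative G d \<Omega> f (graph_map G \<phi> u) L"
    and M: "has_intrinsic_derivative G d W V U \<phi> u M"
  shows "has_extrinsic_derivative G d W V U (f \<circ> graph_map G \<phi>) (graph_map G \<phi> u) (\<lambda>w. L (w \<otimes> M w))"
proof -
  define v where "v = \<phi> u"
  define x where "x = u \<otimes> v"
  have uv: "u \<in> W" "v \<in> V" using U \<phi> by (auto simp: v_def)
  have x: "graph_map G \<phi> u = x" by (simp add: x_def v_def graph_map_def)
  let ?S = "sigma G W V (inv x) ` U"
  define y where "y w = intrinsic_translate G W V \<phi> (inv x) w" for w
  define r where "r p = norm (f (x \<otimes> p) - f x - L p) / hnorm p" for p
  have Lhom: "L \<in> h_hom (G\<lparr>carrier := UNIV\<rparr>) (dilation G) additive_group (*\<^sub>R)"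
    using L by (simp add: has_h_derivative_def flip: carrier_UNIV)
  note Lh = h_hom_additiveD[OF Lhom, simplified]
  have Mhom: "M \<in> h_hom (G\<lparr>carrier := W\<rparr>) (dilation G) (G\<lparr>carrier := V\<rparr>) (dilation G)"
    using M by (simp add: has_intrinsic_derivative_def)
  note Mh = h_hom_VD[OF Mhom]
  have rlim: "(r \<longlongrightarrow> 0) (at 0 within {w. x \<otimes> w \<in> \<Omega>})"
    using L by (simp add: has_h_derivative_def r_def[abs_def] x)
  have Mlim: "((\<lambda>w. d (M w) (y w) / hnorm w) \<longlongrightarrow> 0) (at 0 within ?S)"
    using M by (simp add: has_intrinsic_derivative_def Let_def y_def x)
  obtain C where C: "C \<ge> 0" "\<And>p. norm (L p) \<le> C * hnorm p"
    using homogeneous_additive_bounded[OF homogeneous_UNIV subset_UNIV, of L] Lh by auto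
  obtain B where B: "B \<ge> 0" "\<And>w. w \<in> W \<Longrightarrow> norm (M w) \<le> B * hnorm w"
    using homogeneous_additive_bounded[OF homogeneous_W layer2_W, of M] Mh(2,3) by blast
  obtain K where K: "K \<ge> 0" "\<And>v. v \<in> V \<Longrightarrow> hnorm v \<le> K * norm v"
    by (rule hnorm_V_le) blast
  have MN: "hnorm (M w) \<le> K * B * hnorm w" if "w \<in> W" for w
    using K(2)[OF Mh(1)[OF that]] mult_left_mono[OF B(2)[OF that] K(1)] by (simp add: mult.assoc)
  have S_eq: "?S = {w \<in> W. sigma G W V x w \<in> U}"
    unfolding x_def by (rule sigma_image[OF uv U(1)])
  then have S: "?S \<subseteq> W" by blast
  have graph: "graph_map G \<phi> (sigma G W V x w) = x \<otimes> (w \<otimes> y w)" for w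
    unfolding x_def y_def by (rule graph_map_sigma[OF uv])
  have sub: "x \<otimes> (w \<otimes> y w) \<in> \<Omega>" if "w \<in> ?S" for w
  proof -
    have "sigma G W V x w \<in> U" using that unfolding S_eq by blast
    then show ?thesis using \<phi>(2) unfolding graph[symmetric] by blast
  qed
  \<comment> \<open>In the coefficient, 1 comes from \<open>w\<close> and \<open>K * B\<close> from
    \<open>M w\<close>; the remaining term is the distance from \<open>M w\<close> to
    \<open>y w\<close>.\<close>
  have yN: "hnorm (w \<otimes> y w) \<le> (1 + K * B) * hnorm w + d (M w) (y w)" if "w \<in> W" for w
    using hnorm_mult_le[of w "y w"] M.triangle[of "y w" "M w" 0] MN[OF that] M.commute[of "y w"]
    by (simp add: distrib_right)
  \<comment> \<open>The limit of \<open>r\<close> is taken in the vector space topology, so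
    smallness in \<open>hnorm\<close> has to be converted. Dividing and multiplying by
    \<open>hnorm w\<close> is harmless since \<open>w\<close> is nonzero.\<close>
  have ynear: "((\<lambda>w. w \<otimes> y w) \<longlongrightarrow> 0) (at 0 within ?S)"
  proof (rule tendsto_0_if_hnorm, rule Lim_null_comparison)
    have "((\<lambda>w. (1 + K * B) * hnorm w + d (M w) (y w) / hnorm w * hnorm w) \<longlongrightarrow> (1 + K * B) * 0 + 0 * 0) (at 0 within ?S)"
      by (intro tendsto_intros Mlim tendsto_hnorm_0)
    then show "((\<lambda>w. (1 + K * B) * hnorm w + d (M w) (y w) / hnorm w * hnorm w) \<longlongrightarrow> 0) (at 0 within ?S)"
      by simp
    have "norm (hnorm (w \<otimes> y w)) \<le> (1 + K * B) * hnorm w + d (M w) (y w) / hnorm w * hnorm w"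
      if "w \<in> ?S" "w \<noteq> 0" for w
      using yN[of w] hnorm_pos[OF that(2)] that(1) S by auto
    then show "\<forall>\<^sub>F w in at 0 within ?S. norm (hnorm (w \<otimes> y w)) \<le> (1 + K * B) * hnorm w + d (M w) (y w) / hnorm w * hnorm w"
      by (rule eventually_at_withinI)
  qed
  \<comment> \<open>Division by \<open>hnorm 0 = 0\<close> gives 0 by convention. Hence
    \<open>r\<close> is continuous at 0 within its domain and may be composed with
    \<open>w \<otimes> y w\<close>, even where that product is 0.\<close>
  have "r 0 = 0" by (simp add: r_def)
  then have "continuous (at 0 within {w. x \<otimes> w \<in> \<Omega>}) r"
    using rlim by (simp add: continuous_within)
  then have "((\<lambda>w. r (w \<otimes> y w)) \<longlongrightarrow> r 0) (at 0 within ?S)"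
    by (rule continuous_within_tendsto_compose)
      (use sub ynear in \<open>auto intro!: eventually_at_withinI\<close>)
  then have rnear: "((\<lambda>w. r (w \<otimes> y w)) \<longlongrightarrow> 0) (at 0 within ?S)"
    using \<open>r 0 = 0\<close> by simp
  \<comment> \<open>First summand: the error of \<open>f\<close> along
    \<open>w \<otimes> y w\<close>, measured against \<open>hnorm w\<close>. Second: the effect on
    \<open>L\<close> of replacing \<open>y w\<close> by \<open>M w\<close>.\<close>
  let ?b = "\<lambda>w. r (w \<otimes> y w) * ((1 + K * B) + d (M w) (y w) / hnorm w) + C * (d (M w) (y w) / hnorm w)"
  have bound: "norm (norm (f (graph_map G \<phi> (sigma G W V x w)) - f x - L (w \<otimes> M w)) / hnorm w) \<le> ?b w"
    if w: "w \<in> ?S" "w \<noteq> 0" for w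
  proof -
    let ?p = "w \<otimes> y w"
    have N: "hnorm w > 0" using hnorm_pos[OF w(2)] .
    \<comment> \<open>Inserting \<open>M w\<close> and its inverse isolates a right factor whose
      norm is exactly \<open>d (M w) (y w)\<close>; the bound \<open>C\<close> for \<open>L\<close>
      then applies to it.\<close>
    have "?p = (w \<otimes> M w) \<otimes> (inv (M w) \<otimes> y w)"
      by (simp add: m_assoc mult_inv_cancel)
    then have "L ?p = L (w \<otimes> M w) + L (inv (M w) \<otimes> y w)" using Lh(1) by metis
    then have "f (x \<otimes> ?p) - f x - L (w \<otimes> M w) = (f (x \<otimes> ?p) - f x - L ?p) + L (inv (M w) \<otimes> y w)"
      by simp
    then have "norm (f (x \<otimes> ?p) - f x - L (w \<otimes> M w))
        \<le> norm (f (x \<otimes> ?p) - f x - L ?p) + norm (L (inv (M w) \<otimes> y w))"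
      by (metis norm_triangle_ineq)
    moreover have "norm (L (inv (M w) \<otimes> y w)) \<le> C * d (M w) (y w)"
      using C(2)[of "inv (M w) \<otimes> y w"] by (simp add: dist_eq_hnorm[of "M w"] inv_eq)
    moreover have "norm (f (x \<otimes> ?p) - f x - L ?p) = r ?p * hnorm ?p"
    proof (cases "?p = 0")
      case True
      have "L 0 = 0" using Lh(1)[of 0 0] by simp
      then show ?thesis by (simp add: True)
    qed (use hnorm_pos[of ?p] in \<open>simp add: r_def\<close>)
    moreover have "r ?p * hnorm ?p \<le> r ?p * ((1 + K * B) * hnorm w + d (M w) (y w))"
      using yN[of w] w(1) S by (intro mult_left_mono) (auto simp: r_def)
    ultimately have "norm (f (x \<otimes> ?p) - f x - L (w \<otimes> M w))
        \<le> r ?p * ((1 + K * B) * hnorm w + d (M w) (y w)) + C * d (M w) (y w)" by linarith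
    also have "\<dots> = ?b w * hnorm w" using N by (simp add: field_simps)
    finally show ?thesis unfolding graph using N by (simp add: pos_divide_le_eq)
  qed
  have "((\<lambda>w. norm (f (graph_map G \<phi> (sigma G W V x w)) - f x - L (w \<otimes> M w)) / hnorm w) \<longlongrightarrow> 0) (at 0 within ?S)"
  proof (rule Lim_null_comparison)
    show "\<forall>\<^sub>F w in at 0 within ?S.
        norm (norm (f (graph_map G \<phi> (sigma G W V x w)) - f x - L (w \<otimes> M w)) / hnorm w) \<le> ?b w"
      using bound by (rule eventually_at_withinI)
    have "(?b \<longlongrightarrow> 0 * ((1 + K * B) + 0) + C * 0) (at 0 within ?S)"
      by (intro tendsto_intros Mlim rnear)
    then show "(?b \<longlongrightarrow> 0) (at 0 within ?S)" by simp
  qed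
  moreover have "graph_map G \<phi> (projW G W V x) = x"
    using x by (simp add: projW_mult uv x_def)
  \<comment> \<open>The map sending \<open>w\<close> to \<open>w \<otimes> M w\<close> need not be
    multiplicative. After \<open>L\<close> the target is commutative, so the four factors can be
    rearranged.\<close>
  moreover have "(\<lambda>w. L (w \<otimes> M w)) \<in> h_hom (G\<lparr>carrier := W\<rparr>) (dilation G) additive_group (*\<^sub>R)"
  proof (rule h_hom_additiveI)
    show "L (p \<otimes> q \<otimes> M (p \<otimes> q)) = L (p \<otimes> M p) + L (q \<otimes> M q)" if "p \<in> W" "q \<in> W" for p q
    proof -
      have "M (p \<otimes> q) = M p \<otimes> M q"
        using Mh(2)[OF that] mult_V_eq_add[OF Mh(1)[OF that(1)] Mh(1)[OF that(2)]] by simp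
      then show ?thesis by (simp add: Lh(1))
    qed
    show "L (dilation G t p \<otimes> M (dilation G t p)) = t *\<^sub>R L (p \<otimes> M p)" if "t > 0" "p \<in> W" for t p
    proof -
      have "M (dilation G t p) = dilation G t (M p)"
        using Mh(3)[OF that] Mh(1)[OF that(2)] V_layer1 by (auto simp: dilation_layer1)
      then show ?thesis using Lh(2)[OF that(1)] by (simp flip: dilation_mult)
    qed
  qed
  ultimately show ?thesis
    unfolding has_extrinsic_derivative_def x by simp
qed

section \<open>Functions constant on the graph, and the kernel of the differential\<close>

lemma constant_has_extrinsic_derivative:
  assumes U: "U \<subseteq> W" "u \<in> U" "v \<in> V" and F: "\<And>w. w \<in> U \<Longrightarrow> F w = c"
  shows "has_extrinsic_derivative G d W V U F (u \<otimes> v) (\<lambda>w. 0)"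
proof -
  have u: "u \<in> W" using U by blast
  have "F (sigma G W V (u \<otimes> v) w) - F (projW G W V (u \<otimes> v)) = 0"
    if "w \<in> sigma G W V (inv (u \<otimes> v)) ` U" for w
    using that sigma_image[OF u U(3,1)] F U(2) by (simp add: projW_mult[OF u U(3)])
  then have "\<forall>\<^sub>F w in at 0 within sigma G W V (inv (u \<otimes> v)) ` U.
      norm (F (sigma G W V (u \<otimes> v) w) - F (projW G W V (u \<otimes> v)) - 0) / hnorm w = 0"
    by (intro eventually_at_withinI) simp
  moreover have "(\<lambda>w. 0) \<in> h_hom (G\<lparr>carrier := W\<rparr>) (dilation G) additive_group (*\<^sub>R)"
    by (rule h_hom_additiveI) simp_all
  ultimately show ?thesis
    unfolding has_extrinsic_derivative_def by (simp add: tendsto_eventually)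
qed

text \<open>Factor a kernel element as \<open>w \<otimes> v\<close>. Both \<open>L v\<close> and
  \<open>L (M w)\<close> cancel \<open>L w\<close>, so they agree, and injectivity on
  \<open>V\<close> gives \<open>v = M w\<close>.\<close>

lemma kernel_eq_graph:
  assumes L: "L \<in> h_hom G (dilation G) additive_group (*\<^sub>R)"
    and M: "\<And>w. w \<in> W \<Longrightarrow> M w \<in> V" "graph_map G M ` W \<subseteq> kernel G additive_group L"
    and inj: "inj_on L V"
  shows "kernel G additive_group L = graph_map G M ` W"
proof
  have Lm: "L (p \<otimes> q) = L p + L q" for p q
    using L by (simp add: h_hom_def hom_def additive_group_def)
  show "kernel G additive_group L \<subseteq> graph_map G M ` W"
  proof
    fix p assume "p \<in> kernel G additive_group L"
    then have p: "L p = 0" by (simp add: kernel_def additive_group_def)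
    have "p \<in> W <#> V" by (simp add: WV_UNIV)
    then obtain w v where wv: "w \<in> W" "v \<in> V" "p = w \<otimes> v" by (auto simp: set_mult_def)
    have "L (w \<otimes> M w) = 0"
      using M(2) wv(1) by (auto simp: kernel_def additive_group_def graph_map_def)
    then have "L v = L (M w)" using p wv(3) Lm by (metis add_left_cancel)
    then have "v = M w" using inj wv M(1) by (auto dest: inj_onD)
    then show "p \<in> graph_map G M ` W" using wv by (auto simp: graph_map_def)
  qed
qed (rule M(2))

end

text \<open>Constancy of \<open>f\<close> on the graph yields the inclusion of the graph in the
  kernel. Equality is stated for a differential injective on \<open>V\<close>, a condition that
  equality itself forces by \<open>kernel_eq_graph_imp_inj_on\<close>.\<close>

theorem theorem2p2:
  fixes G :: "('a::euclidean_space) heis"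
    and n :: nat
    and d :: "'a \<Rightarrow> 'a \<Rightarrow> real"
    and W V U \<Omega> :: "'a set"
    and f :: "'a \<Rightarrow> real ^ 'k"
    and \<phi> :: "'a \<Rightarrow> 'a"
    and xW x :: 'a
  assumes "heisenberg n G"
    and "homogeneous_distance G d"
    and "semidirect_factorization G W V"
    and "openin (top_of_set W) U"
    and "open \<Omega>"
    and "\<phi> \<in> U \<rightarrow> V"
    and "graph_map G \<phi> ` U \<subseteq> \<Omega>"
    and "xW \<in> U"
    and "x = graph_map G \<phi> xW"
    and "h_differentiable G d \<Omega> f x"
    and "intrinsic_differentiable G d W V U \<phi> xW"
  shows "extrinsically_differentiable G d W V U (f \<circ> graph_map G \<phi>) xW x
    \<and> (\<forall>w\<in>W. extrinsic_derivative G d W V U (f \<circ> graph_map G \<phi>) x w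
          = h_derivative G d \<Omega> f x (w \<otimes>\<^bsub>G\<^esub> intrinsic_derivative G d W V U \<phi> xW w))
    \<and> ((\<exists>c. \<forall>w\<in>U. f (w \<otimes>\<^bsub>G\<^esub> \<phi> w) = c) \<longrightarrow>
          graph_map G (intrinsic_derivative G d W V U \<phi> xW) ` W
            \<subseteq> kernel G additive_group (h_derivative G d \<Omega> f x)
        \<and> (inj_on (h_derivative G d \<Omega> f x) V \<longrightarrow>
            kernel G additive_group (h_derivative G d \<Omega> f x)
              = graph_map G (intrinsic_derivative G d W V U \<phi> xW) ` W))"
proof -
  interpret heisenberg_factorization G n d W V
    using assms by unfold_locales
  let ?L = "h_derivative G d \<Omega> f x" and ?M = "intrinsic_derivative G d W V U \<phi> xW"
  let ?F = "f \<circ> graph_map G \<phi>"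
  let ?D = "extrinsic_derivative G d W V U ?F x"
  have U: "U \<subseteq> W" using assms(4) by (rule openin_imp_subset)
  have xW: "xW \<in> W" "\<phi> xW \<in> V" and x: "x = xW \<otimes>\<^bsub>G\<^esub> \<phi> xW"
    using U assms(6,8,9) by (auto simp: graph_map_def)
  have L: "has_h_derivative G d \<Omega> f x ?L"
    using assms(10) someI_ex[of "has_h_derivative G d \<Omega> f x"]
    unfolding h_differentiable_def h_derivative_def by simp
  have M: "has_intrinsic_derivative G d W V U \<phi> xW ?M"
    using assms(11) someI_ex[of "has_intrinsic_derivative G d W V U \<phi> xW"]
    unfolding intrinsic_differentiable_def intrinsic_derivative_def by simp
  have chain: "has_extrinsic_derivative G d W V U ?F x (\<lambda>w. ?L (w \<otimes>\<^bsub>G\<^esub> ?M w))"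
    using chain_rule[OF U assms(8,6,7)] L M assms(9) by simp
  \<comment> \<open>The chain rule provides a witness, so the map picked by the choice operator is
    an extrinsic differential too; uniqueness will identify the two on \<open>W\<close>.\<close>
  then have D: "has_extrinsic_derivative G d W V U ?F x ?D"
    unfolding extrinsic_derivative_def by (rule someI[where P = "has_extrinsic_derivative G d W V U ?F x"])
  have unique: "L1 w = L2 w" if "has_extrinsic_derivative G d W V U ?F x L1"
    "has_extrinsic_derivative G d W V U ?F x L2" "w \<in> W" for L1 L2 w
    using has_extrinsic_derivative_unique[OF xW assms(4,8)] that unfolding x by blast
  have graph: "graph_map G ?M ` W \<subseteq> kernel G additive_group ?L"
    if c: "\<exists>c. \<forall>w\<in>U. f (w \<otimes>\<^bsub>G\<^esub> \<phi> w) = c"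
  proof -
    obtain c where "\<And>w. w \<in> U \<Longrightarrow> ?F w = c" using c by (auto simp: graph_map_def)
    then have "has_extrinsic_derivative G d W V U ?F x (\<lambda>w. 0)"
      unfolding x by (rule constant_has_extrinsic_derivative[OF U assms(8) xW(2)])
    then have "?L (w \<otimes>\<^bsub>G\<^esub> ?M w) = 0" if "w \<in> W" for w
      using unique[OF chain _ that] by blast
    then show ?thesis by (auto simp: kernel_def additive_group_def graph_map_def)
  qed
  have "?L \<in> h_hom G (dilation G) additive_group (*\<^sub>R)"
    using L by (simp add: has_h_derivative_def)
  moreover have "?M w \<in> V" if "w \<in> W" for w
    using M h_hom_VD(1)[OF _ that] by (simp add: has_intrinsic_derivative_def)
  ultimately have "kernel G additive_group ?L = graph_map G ?M ` W"
    if "\<exists>c. \<forall>w\<in>U. f (w \<otimes>\<^bsub>G\<^esub> \<phi> w) = c" "inj_on ?L V"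
    using kernel_eq_graph graph that by blast
  moreover have "extrinsically_differentiable G d W V U ?F xW x"
    unfolding extrinsically_differentiable_def using chain assms(8) xW(2) x by blast
  moreover have "\<forall>w\<in>W. ?D w = ?L (w \<otimes>\<^bsub>G\<^esub> ?M w)"
    using unique[OF D chain] by blast
  ultimately show ?thesis using graph by blast
qed

end
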